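(* Let $\mathbb{T}$ be an algebraic theory. Then the variety $\mathbb{T}\text{-}\mathrm{Mod}$ of $\mathbb{T}$-models is a cartesian closed category if and only if $\mathbb{T}$ is hyperaffine--unary, i.e., if and only if for every set $I$ and every operation $t \in T(I)$ there exist a unique hyperaffine operation $h \in T(I)$ and a unique unary operation $m \in T(1)$ (uniqueness being that of the pair $(h,m)$) such that $t = h(\lambda i.\, m(x_i))$.
   Context: Notation: for sets $I,J$, $J^I$ is the set of functions $I \to J$; $u_i$ is the value of $u\in J^I$ at $i$; $\lambda i.\, t_i$ is the function $i \mapsto t_i$. A natural number $n$ is identified with $\{1,\dots,n\}$. An algebraic theory $\mathbb{T}$ comprises: for each set $I$, a set $T(I)$ (the operations of arity $I$); for each set $I$ and $i\in I$, an element $\pi_i \in T(I)$ (the $i$th projection); and for all sets $I,J$, a substitution function $T(I)\times T(J)^I \to T(J)$, $(t,u)\mapsto t(u)$; subject to: $t(\lambda i.\,\pi_i)=t$ for $t \in T(I)$; $\pi_i(u)=u_i$ for $u\in T(J)^I$, $i \in I$; and $(t(u))(v) = t(\lambda i.\, u_i(v))$ for $t\in T(I)$, $u\in T(J)^I$, $v\in T(K)^J$. Operations in $T(1)$ are called unary. Variable notation: equations in variables $x, y, x_i, x_{ij},\dots$ are read as universally quantified over all sets $K$ and all elements $x,y,x_i,x_{ij},\dots$ of $T(K)$ (equivalently, as the equation obtained by substituting distinct projections for distinct variables). E.g. "$t = h(\lambda i.\, m(x_i))$" means that $t(x) = h(\lambda i.\, m(x_i))$ for all families $x$. A model of $\mathbb{T}$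 is a (possibly empty) set $X$ with, for each set $I$, a function $T(I)\times X^I\to X$, $(t,x)\mapsto [\![t]\!](x)$, such that $[\![\pi_i]\!](x)=x_i$ and $[\![t(u)]\!](x)=[\![t]\!](\lambda i.\,[\![u_i]\!](x))$. Homomorphisms of models are functions $f$ with $f([\![t]\!](x)) = [\![t]\!](\lambda i.\, f(x_i))$. $\mathbb{T}\text{-}\mathrm{Mod}$ is the category of models and homomorphisms. An operation $t \in T(I)$ is affine if $t(\lambda i.\, x) = x$ in $T(1)$, and hyperaffine if in addition $t(\lambda i.\, t(\lambda j.\, x_{ij})) = t(\lambda i.\, x_{ii})$ in $T(I\times I)$. *)

theory Defs
  imports "HOL-Library.FuncSet"
begin

unbundle cardinal_syntax

section \<open>Sets\<close>

text \<open>
  The mathematics quantifies over all sets: arities, carriers of operations and carriers of models.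
  The sets are rendered as the small subsets of a type \<open>'u\<close> that plays the role of a Grothendieck
  universe: the cardinality of \<open>'u\<close> is infinite, regular and a strong limit, and a subset is small
  if its cardinality is less than that of \<open>'u\<close>. Every set of any type with cardinality less than that of \<open>'u\<close>
  is then in bijection with a small subset of \<open>'u\<close>.
\<close>

definition small :: "'u set \<Rightarrow> bool" where
  "small A \<longleftrightarrow> |A| <o |UNIV :: 'u set|"

class set_universe =
  assumes infinite_universe: "infinite (UNIV :: 'a set)"
    and small_UN: "small (A :: 'a set) \<Longrightarrow> (\<And>a. a \<in> A \<Longrightarrow> small (F a :: 'a set)) \<Longrightarrow> small (\<Union>a\<in>A. F a)"
    and small_Pow: "small (A :: 'a set) \<Longrightarrow> |Pow A| <o |UNIV :: 'a set|"

text \<open>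
  Uncountability is not required, as in those definitions of Grothendieck universes that admit the
  universe of hereditarily finite sets; the latter is the following instance.
\<close>

instance nat :: set_universe
proof
  have small_iff: "small A \<longleftrightarrow> finite A" for A :: "nat set"
    unfolding small_def
    by (metis card_of_nat finite_iff_ordLess_natLeq ordIso_symmetric ordLess_ordIso_trans)
  show "infinite (UNIV :: nat set)" by simp
  show "small (\<Union>a\<in>A. F a)" if "small A" "\<And>a. a \<in> A \<Longrightarrow> small (F a)"
    for A :: "nat set" and F :: "nat \<Rightarrow> nat set"
    using that by (simp add: small_iff)
  show "|Pow A| <o |UNIV :: nat set|" if "small A" for A :: "nat set"
    using that unfolding small_iff
    by (intro finite_ordLess_infinite card_of_Well_order) (simp_all add: Field_card_of)
qed


section \<open>Algebraic theories\<close>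

text \<open>
  Elements of a function set \<open>J\<^sup>I\<close> are the extensional functions in \<open>I \<rightarrow>\<^sub>E J\<close>. Since operations of
  different arities may be represented by the same element of \<open>'u\<close>, projection and substitution
  take the arities as arguments: \<open>proj T I i\<close> is the \<open>i\<close>-th projection in \<open>ops T I\<close>, and
  \<open>sub T I J t u\<close> is \<open>t(u)\<close> for \<open>t\<close> of arity \<open>I\<close> and a family \<open>u\<close> of operations of arity \<open>J\<close>.
\<close>

record 'u alg_theory =
  ops :: "'u set \<Rightarrow> 'u set"
  proj :: "'u set \<Rightarrow> 'u \<Rightarrow> 'u"
  sub :: "'u set \<Rightarrow> 'u set \<Rightarrow> 'u \<Rightarrow> ('u \<Rightarrow> 'u) \<Rightarrow> 'u"

locale algebraic_theory =
  fixes T :: "'u::set_universe alg_theory"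
  assumes small_ops: "small I \<Longrightarrow> small (ops T I)"
    and proj_in_ops: "small I \<Longrightarrow> i \<in> I \<Longrightarrow> proj T I i \<in> ops T I"
    and sub_in_ops:
      "small I \<Longrightarrow> small J \<Longrightarrow> t \<in> ops T I \<Longrightarrow> u \<in> I \<rightarrow>\<^sub>E ops T J \<Longrightarrow> sub T I J t u \<in> ops T J"
    and sub_projs: "small I \<Longrightarrow> t \<in> ops T I \<Longrightarrow> sub T I I t (\<lambda>i\<in>I. proj T I i) = t"
    and proj_sub:
      "small I \<Longrightarrow> small J \<Longrightarrow> u \<in> I \<rightarrow>\<^sub>E ops T J \<Longrightarrow> i \<in> I \<Longrightarrow> sub T I J (proj T I i) u = u i"
    and sub_sub:
      "small I \<Longrightarrow> small J \<Longrightarrow> small K \<Longrightarrow>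
       t \<in> ops T I \<Longrightarrow> u \<in> I \<rightarrow>\<^sub>E ops T J \<Longrightarrow> v \<in> J \<rightarrow>\<^sub>E ops T K \<Longrightarrow>
       sub T J K (sub T I J t u) v = sub T I K t (\<lambda>i\<in>I. sub T J K (u i) v)"

text \<open>
  The arity \<open>1\<close> is a singleton; the choice of its element is immaterial.
\<close>

definition one :: "'u set" where
  "one = {undefined}"

definition app1 :: "'u alg_theory \<Rightarrow> 'u set \<Rightarrow> 'u \<Rightarrow> 'u \<Rightarrow> 'u" where
  "app1 T K m x = sub T one K m (\<lambda>_\<in>one. x)"

text \<open>
  An equation in variables is read as universally quantified over all sets \<open>K\<close> and all elements
  of \<open>T(K)\<close> for the variables.
\<close>

definition affine :: "'u alg_theory \<Rightarrow> 'u set \<Rightarrow> 'u \<Rightarrow> bool" where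
  "affine T I t \<longleftrightarrow> (\<forall>K. small K \<longrightarrow> (\<forall>x \<in> ops T K. sub T I K t (\<lambda>i\<in>I. x) = x))"

definition hyperaffine :: "'u alg_theory \<Rightarrow> 'u set \<Rightarrow> 'u \<Rightarrow> bool" where
  "hyperaffine T I t \<longleftrightarrow> affine T I t \<and>
     (\<forall>K. small K \<longrightarrow> (\<forall>x. (\<forall>i\<in>I. \<forall>j\<in>I. x i j \<in> ops T K) \<longrightarrow>
        sub T I K t (\<lambda>i\<in>I. sub T I K t (\<lambda>j\<in>I. x i j)) = sub T I K t (\<lambda>i\<in>I. x i i)))"

definition decomposes :: "'u alg_theory \<Rightarrow> 'u set \<Rightarrow> 'u \<Rightarrow> 'u \<Rightarrow> 'u \<Rightarrow> bool" where
  "decomposes T I t h m \<longleftrightarrow>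
     (\<forall>K. small K \<longrightarrow> (\<forall>x \<in> I \<rightarrow>\<^sub>E ops T K.
        sub T I K t x = sub T I K h (\<lambda>i\<in>I. app1 T K m (x i))))"

definition hyperaffine_unary :: "'u alg_theory \<Rightarrow> bool" where
  "hyperaffine_unary T \<longleftrightarrow>
     (\<forall>I. small I \<longrightarrow> (\<forall>t \<in> ops T I.
        \<exists>!p. case p of (h, m) \<Rightarrow>
          h \<in> ops T I \<and> hyperaffine T I h \<and> m \<in> ops T one \<and> decomposes T I t h m))"


section \<open>Cartesian closed categories\<close>

text \<open>
  Hom-sets need not be disjoint, so composition takes the three objects as arguments:
  \<open>Comp C X Y Z g f\<close> is \<open>g \<circ> f\<close> for \<open>f : X \<rightarrow> Y\<close> and \<open>g : Y \<rightarrow> Z\<close>.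
\<close>

record ('o, 'm) cat =
  Obj :: "'o set"
  Hom :: "'o \<Rightarrow> 'o \<Rightarrow> 'm set"
  Id :: "'o \<Rightarrow> 'm"
  Comp :: "'o \<Rightarrow> 'o \<Rightarrow> 'o \<Rightarrow> 'm \<Rightarrow> 'm \<Rightarrow> 'm"

locale category =
  fixes C :: "('o, 'm) cat"
  assumes Id_in_Hom: "X \<in> Obj C \<Longrightarrow> Id C X \<in> Hom C X X"
    and Comp_in_Hom:
      "X \<in> Obj C \<Longrightarrow> Y \<in> Obj C \<Longrightarrow> Z \<in> Obj C \<Longrightarrow> f \<in> Hom C X Y \<Longrightarrow> g \<in> Hom C Y Z \<Longrightarrow>
       Comp C X Y Z g f \<in> Hom C X Z"
    and Comp_Id_right:
      "X \<in> Obj C \<Longrightarrow> Y \<in> Obj C \<Longrightarrow> f \<in> Hom C X Y \<Longrightarrow> Comp C X X Y f (Id C X) = f"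
    and Comp_Id_left:
      "X \<in> Obj C \<Longrightarrow> Y \<in> Obj C \<Longrightarrow> f \<in> Hom C X Y \<Longrightarrow> Comp C X Y Y (Id C Y) f = f"
    and Comp_assoc:
      "W \<in> Obj C \<Longrightarrow> X \<in> Obj C \<Longrightarrow> Y \<in> Obj C \<Longrightarrow> Z \<in> Obj C \<Longrightarrow>
       f \<in> Hom C W X \<Longrightarrow> g \<in> Hom C X Y \<Longrightarrow> h \<in> Hom C Y Z \<Longrightarrow>
       Comp C W X Z (Comp C X Y Z h g) f = Comp C W Y Z h (Comp C W X Y g f)"

definition terminal :: "('o, 'm) cat \<Rightarrow> 'o \<Rightarrow> bool" where
  "terminal C U \<longleftrightarrow> U \<in> Obj C \<and> (\<forall>X \<in> Obj C. \<exists>!f. f \<in> Hom C X U)"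

definition is_product :: "('o, 'm) cat \<Rightarrow> 'o \<Rightarrow> 'o \<Rightarrow> 'o \<Rightarrow> 'm \<Rightarrow> 'm \<Rightarrow> bool" where
  "is_product C A B P p q \<longleftrightarrow>
     P \<in> Obj C \<and> p \<in> Hom C P A \<and> q \<in> Hom C P B \<and>
     (\<forall>Z \<in> Obj C. \<forall>f \<in> Hom C Z A. \<forall>g \<in> Hom C Z B.
        \<exists>!k. k \<in> Hom C Z P \<and> Comp C Z P A p k = f \<and> Comp C Z P B q k = g)"

text \<open>
  \<open>E\<close> with \<open>ev : E \<times> A \<rightarrow> B\<close> is an exponential \<open>B\<^sup>A\<close>, where \<open>P\<close> with projections \<open>p\<close>, \<open>q\<close> is the
  product \<open>E \<times> A\<close>: for every product \<open>Q = Z \<times> A\<close>, every \<open>g : Z \<times> A \<rightarrow> B\<close> is \<open>ev \<circ> (f \<times> A)\<close>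
  for a unique \<open>f : Z \<rightarrow> E\<close>. The morphism \<open>k\<close> is \<open>f \<times> A\<close>.
\<close>

definition is_exponential ::
    "('o, 'm) cat \<Rightarrow> 'o \<Rightarrow> 'o \<Rightarrow> 'o \<Rightarrow> 'o \<Rightarrow> 'm \<Rightarrow> 'm \<Rightarrow> 'm \<Rightarrow> bool" where
  "is_exponential C A B E P p q ev \<longleftrightarrow>
     E \<in> Obj C \<and> is_product C E A P p q \<and> ev \<in> Hom C P B \<and>
     (\<forall>Z \<in> Obj C. \<forall>Q p' q'. is_product C Z A Q p' q' \<longrightarrow>
        (\<forall>g \<in> Hom C Q B. \<exists>!f. f \<in> Hom C Z E \<and>
           (\<exists>k \<in> Hom C Q P.
              Comp C Q P E p k = Comp C Q Z E f p' \<and> Comp C Q P A q k = q' \<and>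
              Comp C Q P B ev k = g)))"

definition cartesian_closed :: "('o, 'm) cat \<Rightarrow> bool" where
  "cartesian_closed C \<longleftrightarrow>
     category C \<and>
     (\<exists>U. terminal C U) \<and>
     (\<forall>A \<in> Obj C. \<forall>B \<in> Obj C. \<exists>P p q. is_product C A B P p q) \<and>
     (\<forall>A \<in> Obj C. \<forall>B \<in> Obj C. \<exists>E P p q ev. is_exponential C A B E P p q ev)"


section \<open>The category of models\<close>

text \<open>
  \<open>interp X I t x\<close> is \<open>\<lbrakk>t\<rbrakk>(x)\<close> for \<open>t\<close> of arity \<open>I\<close>. Values of \<open>interp\<close> on arguments outside the
  domain of a model structure are not constrained; models that differ only there are isomorphic
  by the identity map.
\<close>

record 'u model =
  carr :: "'u set"
  interp :: "'u set \<Rightarrow> 'u \<Rightarrow> ('u \<Rightarrow> 'u) \<Rightarrow> 'u"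

definition is_model :: "'u alg_theory \<Rightarrow> 'u model \<Rightarrow> bool" where
  "is_model T X \<longleftrightarrow>
     small (carr X) \<and>
     (\<forall>I. small I \<longrightarrow>
        (\<forall>t \<in> ops T I. \<forall>x \<in> I \<rightarrow>\<^sub>E carr X. interp X I t x \<in> carr X)) \<and>
     (\<forall>I. small I \<longrightarrow>
        (\<forall>i \<in> I. \<forall>x \<in> I \<rightarrow>\<^sub>E carr X. interp X I (proj T I i) x = x i)) \<and>
     (\<forall>I J. small I \<longrightarrow> small J \<longrightarrow>
        (\<forall>t \<in> ops T I. \<forall>u \<in> I \<rightarrow>\<^sub>E ops T J. \<forall>x \<in> J \<rightarrow>\<^sub>E carr X.
           interp X J (sub T I J t u) x = interp X I t (\<lambda>i\<in>I. interp X J (u i) x)))"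

definition model_homs :: "'u alg_theory \<Rightarrow> 'u model \<Rightarrow> 'u model \<Rightarrow> ('u \<Rightarrow> 'u) set" where
  "model_homs T X Y =
     {f \<in> carr X \<rightarrow>\<^sub>E carr Y.
        \<forall>I. small I \<longrightarrow> (\<forall>t \<in> ops T I. \<forall>x \<in> I \<rightarrow>\<^sub>E carr X.
          f (interp X I t x) = interp Y I t (\<lambda>i\<in>I. f (x i)))}"

definition Mod :: "'u alg_theory \<Rightarrow> ('u model, 'u \<Rightarrow> 'u) cat" where
  "Mod T =
     \<lparr>Obj = {X. is_model T X},
      Hom = model_homs T,
      Id = (\<lambda>X. \<lambda>x\<in>carr X. x),
      Comp = (\<lambda>X Y Z g f. compose (carr X) g f)\<rparr>"

end

theory Submission
  imports Defs
begin

text \<open>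
  If exponents exist, then products distribute over copowers, so for each set \<open>I\<close> there is a unique
  homomorphism \<open>\<theta> : T(I) \<times> T(1) \<rightarrow> T(I)\<close> with \<open>\<theta>(p(\<pi>\<^sub>i), n) = n(\<pi>\<^sub>i)\<close>. The operation \<open>h = \<theta>(t, \<pi>)\<close> is
  hyperaffine, \<open>\<theta>(t, m) = h(\<lambda>i. m(\<pi>\<^sub>i))\<close>, and \<open>\<theta>(t, t(\<lambda>i. \<pi>)) = t\<close>, all because both sides are values of
  homomorphisms that agree on the copower summands.

  Conversely, let every \<open>t\<close> have a unique decomposition \<open>h(\<lambda>i. m(x\<^sub>i))\<close>; then \<open>m = t(\<lambda>i. x)\<close>, and all affine
  operations are hyperaffine. The exponent \<open>B\<^sup>A\<close> is the set of homomorphisms \<open>T(1) \<times> A \<rightarrow> B\<close> with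
  \<open>\<lbrakk>t\<rbrakk>(f)(n, a) = \<lbrakk>h\<rbrakk>(\<lambda>i. f\<^sub>i(m, a))\<close>, where \<open>(h, m)\<close> decomposes \<open>n(t)\<close>. That this is a model structure rests
  on the exchange law \<open>s(\<lambda>j. h\<^sub>j(\<lambda>i. x\<^sub>i\<^sub>j)) = k(\<lambda>i. s(\<lambda>j. x\<^sub>i\<^sub>j))\<close> for hyperaffine \<open>h\<^sub>j\<close> and a hyperaffine \<open>k\<close> depending
  only on \<open>s\<close> and \<open>h\<close>.
\<close>

section \<open>Small sets\<close>

lemma small_image: "small A \<Longrightarrow> small (f ` A)" for A :: "'u set" and f :: "'u \<Rightarrow> 'u"
  unfolding small_def by (meson card_of_image ordLeq_ordLess_trans)

lemma small_finite: "finite A \<Longrightarrow> small A" for A :: "'u::set_universe set"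
  unfolding small_def using infinite_universe
  by (intro finite_ordLess_infinite card_of_Well_order) (simp_all add: Field_card_of)

lemma small_one: "small (one :: 'u::set_universe set)"
  by (simp add: one_def small_finite)

text \<open>This will turn a set of homomorphisms, which are functions, into a set of elements of
  \<open>'u\<close> that can serve as the carrier of a model.\<close>

lemma ex_small_encoding:
  fixes S :: "'v set"
  assumes "|S| <o |UNIV :: 'u::set_universe set|"
  obtains enc :: "'v \<Rightarrow> 'u::set_universe" where "inj_on enc S" "small (enc ` S)"
proof -
  obtain enc :: "'v \<Rightarrow> 'u" where "inj_on enc S"
    using assms ordLess_imp_ordLeq card_of_ordLeq by metis
  moreover have "small (enc ` S)"
    unfolding small_def using assms card_of_image ordLeq_ordLess_trans by blast
  ultimately show thesis ..
qed

text \<open>Carriers of product models have to be subsets of \<open>'u\<close>, so pairs are coded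
  inside \<open>'u\<close>. A coding exists because an infinite type is equinumerous with its
  square.\<close>

definition pr :: "'u::set_universe \<Rightarrow> 'u \<Rightarrow> 'u" where
  "pr = (SOME f. inj (\<lambda>(a, b). f a b))"

lemma inj_pr: "inj (\<lambda>(a, b). pr (a :: 'u::set_universe) b)"
proof -
  have "|UNIV \<times> UNIV :: ('u \<times> 'u) set| =o |UNIV :: 'u set|"
    by (intro card_of_Times_same_infinite infinite_universe)
  then obtain f :: "'u \<times> 'u \<Rightarrow> 'u" where "bij_betw f UNIV UNIV"
    using card_of_ordIso by (metis UNIV_Times_UNIV)
  then have "inj (\<lambda>(a, b). (curry f) a b)"
    by (simp add: bij_betw_def)
  then show ?thesis
    unfolding pr_def by (rule someI[where P = "\<lambda>f. inj (\<lambda>(a, b). f a b)"])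
qed

definition pfst :: "'u::set_universe \<Rightarrow> 'u" where
  "pfst c = fst (inv (\<lambda>(a, b). pr a b) c)"

definition psnd :: "'u::set_universe \<Rightarrow> 'u" where
  "psnd c = snd (inv (\<lambda>(a, b). pr a b) c)"

lemma pfst_pr [simp]: "pfst (pr a b) = a"
  unfolding pfst_def using inv_f_f[OF inj_pr, of "(a, b)"] by simp

lemma psnd_pr [simp]: "psnd (pr a b) = b"
  unfolding psnd_def using inv_f_f[OF inj_pr, of "(a, b)"] by simp

definition pairs :: "'u::set_universe set \<Rightarrow> 'u set \<Rightarrow> 'u set" where
  "pairs A B = (\<Union>a\<in>A. pr a ` B)"

text \<open>The components of an element outside the range of \<open>pr\<close> are arbitrary; the
  third conjunct excludes such elements.\<close>

lemma in_pairs_iff [simp]: "c \<in> pairs A B \<longleftrightarrow> pfst c \<in> A \<and> psnd c \<in> B \<and> pr (pfst c) (psnd c) = c"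
  unfolding pairs_def by (auto simp: image_iff) metis

lemma small_pairs: "small A \<Longrightarrow> small B \<Longrightarrow> small (pairs A B)"
  unfolding pairs_def by (intro small_UN small_image)

text \<open>Extensional functions are determined by their graphs, which are subsets of the small set
  \<open>pairs A B\<close>.\<close>

lemma card_funcset_less:
  fixes A B :: "'u::set_universe set"
  assumes "small A" "small B"
  shows "|A \<rightarrow>\<^sub>E B| <o |UNIV :: 'u set|"
proof -
  have "inj_on (\<lambda>f. (\<lambda>a. pr a (f a)) ` A) (A \<rightarrow>\<^sub>E B)"
  proof (rule inj_onI)
    fix f g assume f: "f \<in> A \<rightarrow>\<^sub>E B" and g: "g \<in> A \<rightarrow>\<^sub>E B"
      and eq: "(\<lambda>a. pr a (f a)) ` A = (\<lambda>a. pr a (g a)) ` A"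
    have "f a = g a" if "a \<in> A" for a
    proof -
      have "pr a (f a) \<in> (\<lambda>a. pr a (g a)) ` A"
        using that eq by blast
      then obtain b where "pr a (f a) = pr b (g b)" by blast
      then show ?thesis by (metis pfst_pr psnd_pr)
    qed
    with f g show "f = g" by (rule PiE_ext)
  qed
  moreover have "(\<lambda>f. (\<lambda>a. pr a (f a)) ` A) ` (A \<rightarrow>\<^sub>E B) \<subseteq> Pow (pairs A B)"
    by (auto simp: PiE_mem)
  ultimately have "|A \<rightarrow>\<^sub>E B| \<le>o |Pow (pairs A B)|"
    using card_of_ordLeq by blast
  then show ?thesis
    using small_Pow[OF small_pairs[OF assms]] by (rule ordLeq_ordLess_trans)
qed


section \<open>Models\<close>

text \<open>Unlike \<open>interp\<close>, the following accepts families that are not extensional.\<close>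

definition ap :: "'u model \<Rightarrow> 'u set \<Rightarrow> 'u \<Rightarrow> ('u \<Rightarrow> 'u) \<Rightarrow> 'u" where
  "ap X I t x = interp X I t (restrict x I)"

abbreviation un :: "'u model \<Rightarrow> 'u \<Rightarrow> 'u \<Rightarrow> 'u" where
  "un X m x \<equiv> ap X one m (\<lambda>_. x)"

definition free :: "'u alg_theory \<Rightarrow> 'u set \<Rightarrow> 'u model" where
  "free T K = \<lparr>carr = ops T K, interp = (\<lambda>I. sub T I K)\<rparr>"

text \<open>The generic element: a homomorphism out of \<open>free T one\<close> is determined by
  its value here, and as a unary operation it is the identity.\<close>

definition gen :: "'u alg_theory \<Rightarrow> 'u" where
  "gen T = proj T one undefined"

text \<open>Without the extensionality of \<open>model_homs\<close>, homomorphisms can be composed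
  as plain lambda terms; their equality is then stated pointwise on carriers.\<close>

definition hom :: "'u alg_theory \<Rightarrow> 'u model \<Rightarrow> 'u model \<Rightarrow> ('u \<Rightarrow> 'u) \<Rightarrow> bool" where
  "hom T X Y f \<longleftrightarrow> (\<forall>x\<in>carr X. f x \<in> carr Y) \<and>
     (\<forall>I t x. small I \<longrightarrow> t \<in> ops T I \<longrightarrow> (\<forall>i\<in>I. x i \<in> carr X) \<longrightarrow>
        f (ap X I t x) = ap Y I t (\<lambda>i. f (x i)))"

text \<open>A curried homomorphism from the product \<open>W \<times> Y\<close>, not a homomorphism in each variable separately.\<close>

definition bihom ::
    "'u alg_theory \<Rightarrow> 'u model \<Rightarrow> 'u model \<Rightarrow> 'u model \<Rightarrow> ('u \<Rightarrow> 'u \<Rightarrow> 'u) \<Rightarrow> bool" where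
  "bihom T W Y Z g \<longleftrightarrow> (\<forall>w\<in>carr W. \<forall>y\<in>carr Y. g w y \<in> carr Z) \<and>
     (\<forall>I t w y. small I \<longrightarrow> t \<in> ops T I \<longrightarrow> (\<forall>i\<in>I. w i \<in> carr W) \<longrightarrow> (\<forall>i\<in>I. y i \<in> carr Y) \<longrightarrow>
        g (ap W I t w) (ap Y I t y) = ap Z I t (\<lambda>i. g (w i) (y i)))"

text \<open>As a congruence rule this gives the simplifier the membership of the index under the
  binder, on which the computations with nested families rest.\<close>

lemma ap_cong [cong]:
  "X = Y \<Longrightarrow> I = J \<Longrightarrow> t = s \<Longrightarrow> (\<And>i. i \<in> J =simp=> x i = y i) \<Longrightarrow> ap X I t x = ap Y J s y"
  unfolding ap_def simp_implies_def by (metis restrict_ext)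

lemma ap_eqI: "(\<And>i. i \<in> I \<Longrightarrow> x i = y i) \<Longrightarrow> ap X I t x = ap X I t y"
  by simp

lemma carr_free [simp]: "carr (free T K) = ops T K"
  by (simp add: free_def)

lemma ap_free: "ap (free T K) I t x = sub T I K t (restrict x I)"
  by (simp add: free_def ap_def)

lemma ball_PiE_iff:
  "(\<forall>x\<in>I \<rightarrow>\<^sub>E A. Q x) \<longleftrightarrow> (\<forall>x. (\<forall>i\<in>I. x i \<in> A) \<longrightarrow> Q (restrict x I))"
proof
  assume "\<forall>x. (\<forall>i\<in>I. x i \<in> A) \<longrightarrow> Q (restrict x I)"
  then show "\<forall>x\<in>I \<rightarrow>\<^sub>E A. Q x"
    by (metis PiE_mem PiE_restrict)
qed simp

text \<open>Writing substitution as application in a free model makes operations and elements of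
  models subject to the same calculus of \<open>ap\<close>.\<close>

lemma is_model_iff:
  "is_model T X \<longleftrightarrow> small (carr X) \<and>
     (\<forall>I t x. small I \<longrightarrow> t \<in> ops T I \<longrightarrow> (\<forall>i\<in>I. x i \<in> carr X) \<longrightarrow> ap X I t x \<in> carr X) \<and>
     (\<forall>I i x. small I \<longrightarrow> i \<in> I \<longrightarrow> (\<forall>i\<in>I. x i \<in> carr X) \<longrightarrow> ap X I (proj T I i) x = x i) \<and>
     (\<forall>I J t u x. small I \<longrightarrow> small J \<longrightarrow> t \<in> ops T I \<longrightarrow> (\<forall>i\<in>I. u i \<in> ops T J) \<longrightarrow>
        (\<forall>j\<in>J. x j \<in> carr X) \<longrightarrow>
        ap X J (ap (free T J) I t u) x = ap X I t (\<lambda>i. ap X J (u i) x))"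
    (is "?L \<longleftrightarrow> ?S \<and> ?C \<and> ?P \<and> ?A")
proof -
  have 1: "(\<forall>I. small I \<longrightarrow> (\<forall>t\<in>ops T I. \<forall>x\<in>I \<rightarrow>\<^sub>E carr X. interp X I t x \<in> carr X)) \<longleftrightarrow> ?C"
    unfolding ball_PiE_iff ap_def by blast
  have 2: "(\<forall>I. small I \<longrightarrow> (\<forall>i\<in>I. \<forall>x\<in>I \<rightarrow>\<^sub>E carr X. interp X I (proj T I i) x = x i)) \<longleftrightarrow> ?P"
    unfolding ball_PiE_iff ap_def by (simp) blast
  have 3: "(\<forall>I J. small I \<longrightarrow> small J \<longrightarrow>
        (\<forall>t \<in> ops T I. \<forall>u \<in> I \<rightarrow>\<^sub>E ops T J. \<forall>x \<in> J \<rightarrow>\<^sub>E carr X.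
           interp X J (sub T I J t u) x = interp X I t (\<lambda>i\<in>I. interp X J (u i) x))) \<longleftrightarrow> ?A"
    unfolding ball_PiE_iff ap_free unfolding ap_def by (simp cong: restrict_cong) blast
  show ?thesis
    unfolding is_model_def 1 2 3 ..
qed

lemma model_homs_iff:
  "f \<in> model_homs T X Y \<longleftrightarrow> f \<in> extensional (carr X) \<and> hom T X Y f"
  unfolding model_homs_def hom_def mem_Collect_eq ball_PiE_iff ap_def unfolding PiE_def
  by (simp cong: restrict_cong add: Pi_def) blast

section \<open>Binary products of models\<close>

definition prd :: "'u::set_universe model \<Rightarrow> 'u model \<Rightarrow> 'u model" where
  "prd X Y = \<lparr>carr = pairs (carr X) (carr Y),
     interp = (\<lambda>I t z. pr (ap X I t (\<lambda>i. pfst (z i))) (ap Y I t (\<lambda>i. psnd (z i))))\<rparr>"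

lemma carr_prd [simp]: "carr (prd X Y) = pairs (carr X) (carr Y)"
  by (simp add: prd_def)

lemma ap_prd: "ap (prd X Y) I t z = pr (ap X I t (\<lambda>i. pfst (z i))) (ap Y I t (\<lambda>i. psnd (z i)))"
  unfolding ap_def prd_def by (simp cong: restrict_cong)

context algebraic_theory
begin

section \<open>Homomorphisms, free models and maps out of products\<close>

lemma hom_closed: "hom T X Y f \<Longrightarrow> x \<in> carr X \<Longrightarrow> f x \<in> carr Y"
  by (simp add: hom_def)

lemma hom_ap:
  "hom T X Y f \<Longrightarrow> small I \<Longrightarrow> t \<in> ops T I \<Longrightarrow> (\<And>i. i \<in> I \<Longrightarrow> x i \<in> carr X) \<Longrightarrow>
   f (ap X I t x) = ap Y I t (\<lambda>i. f (x i))"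
  by (simp add: hom_def)

lemma bihom_closed: "bihom T W Y Z g \<Longrightarrow> w \<in> carr W \<Longrightarrow> y \<in> carr Y \<Longrightarrow> g w y \<in> carr Z"
  by (simp add: bihom_def)

lemma bihom_ap:
  "bihom T W Y Z g \<Longrightarrow> small I \<Longrightarrow> t \<in> ops T I \<Longrightarrow>
   (\<And>i. i \<in> I \<Longrightarrow> w i \<in> carr W) \<Longrightarrow> (\<And>i. i \<in> I \<Longrightarrow> y i \<in> carr Y) \<Longrightarrow>
   g (ap W I t w) (ap Y I t y) = ap Z I t (\<lambda>i. g (w i) (y i))"
  by (simp add: bihom_def)

lemma is_modelD:
  assumes "is_model T X"
  shows small_carr: "small (carr X)"
    and ap_closed: "small I \<Longrightarrow> t \<in> ops T I \<Longrightarrow> (\<And>i. i \<in> I \<Longrightarrow> x i \<in> carr X) \<Longrightarrow> ap X I t x \<in> carr X"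
    and ap_proj: "small I \<Longrightarrow> i \<in> I \<Longrightarrow> (\<And>i. i \<in> I \<Longrightarrow> x i \<in> carr X) \<Longrightarrow> ap X I (proj T I i) x = x i"
    and ap_ap: "small I \<Longrightarrow> small J \<Longrightarrow> t \<in> ops T I \<Longrightarrow> (\<And>i. i \<in> I \<Longrightarrow> u i \<in> ops T J) \<Longrightarrow>
        (\<And>j. j \<in> J \<Longrightarrow> x j \<in> carr X) \<Longrightarrow>
        ap X J (ap (free T J) I t u) x = ap X I t (\<lambda>i. ap X J (u i) x)"
  using assms unfolding is_model_iff by simp_all

lemma model_free: "small K \<Longrightarrow> is_model T (free T K)"
  unfolding is_model_iff carr_free ap_free
  by (intro conjI allI impI)
    (simp_all add: small_ops sub_in_ops proj_sub sub_sub cong: restrict_cong)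

lemma proj_closed [simp]: "small I \<Longrightarrow> i \<in> I \<Longrightarrow> proj T I i \<in> ops T I"
  by (rule proj_in_ops)

lemma ap_projs: "small I \<Longrightarrow> t \<in> ops T I \<Longrightarrow> ap (free T I) I t (proj T I) = t"
  unfolding ap_free by (metis (no_types) sub_projs)

lemma gen_closed [simp]: "gen T \<in> ops T one"
  unfolding gen_def using small_one by (rule proj_in_ops) (simp add: one_def)

lemma un_gen: "is_model T X \<Longrightarrow> x \<in> carr X \<Longrightarrow> un X (gen T) x = x"
  unfolding gen_def by (rule ap_proj[OF _ small_one]) (auto simp: one_def)

lemma free_ap_closed:
  "small I \<Longrightarrow> small K \<Longrightarrow> t \<in> ops T I \<Longrightarrow> (\<And>i. i \<in> I \<Longrightarrow> x i \<in> ops T K) \<Longrightarrow>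
   ap (free T K) I t x \<in> ops T K"
  using ap_closed[OF model_free, of K I t x] by simp

lemma un_free_gen: "n \<in> ops T one \<Longrightarrow> un (free T one) n (gen T) = n"
proof -
  assume n: "n \<in> ops T one"
  have "un (free T one) n (gen T) = ap (free T one) one n (proj T one)"
    by (rule ap_eqI) (simp add: gen_def one_def)
  then show ?thesis using ap_projs[OF small_one n] by simp
qed

text \<open>The extension of a family of elements to the free model; it preserves operations by the
  substitution law \<open>ap_ap\<close>.\<close>

lemma hom_eval:
  "small K \<Longrightarrow> is_model T X \<Longrightarrow> (\<And>k. k \<in> K \<Longrightarrow> x k \<in> carr X) \<Longrightarrow>
   hom T (free T K) X (\<lambda>t. ap X K t x)"
  unfolding hom_def by (simp add: ap_closed ap_ap)

lemma hom_comp: "hom T X Y f \<Longrightarrow> hom T Y Z g \<Longrightarrow> hom T X Z (\<lambda>x. g (f x))"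
  unfolding hom_def by simp

lemma bihom_comp: "bihom T W Y Z g \<Longrightarrow> hom T Z Z' h \<Longrightarrow> bihom T W Y Z' (\<lambda>w y. h (g w y))"
  unfolding hom_def bihom_def by simp

lemma bihom_precomp:
  "bihom T W Y Z g \<Longrightarrow> hom T W' W f \<Longrightarrow> hom T Y' Y h \<Longrightarrow> bihom T W' Y' Z (\<lambda>w y. g (f w) (h y))"
  unfolding hom_def bihom_def by simp

text \<open>The argument \<open>w\<close> may be duplicated because \<open>bihom\<close> means a
  homomorphism on the product, and the diagonal of \<open>W\<close> is a homomorphism.\<close>

lemma bihom_diag:
  assumes "bihom T W V Z \<phi>" "bihom T W Y V \<theta>"
  shows "bihom T W Y Z (\<lambda>w y. \<phi> w (\<theta> w y))"
  using assms unfolding bihom_def by simp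

lemma hom_id: "hom T X X (\<lambda>x. x)"
  unfolding hom_def by simp

lemma hom_restrict: "is_model T X \<Longrightarrow> hom T X Y f \<Longrightarrow> hom T X Y (restrict f (carr X))"
  unfolding hom_def by (simp add: ap_closed)

lemma bihom_snd: "hom T Y Z g \<Longrightarrow> bihom T X Y Z (\<lambda>_. g)"
  unfolding hom_def bihom_def by simp

lemma model_prd:
  assumes "is_model T X" "is_model T Y"
  shows "is_model T (prd X Y)"
  unfolding is_model_iff carr_prd
  by (intro conjI allI impI) (simp_all add: small_pairs small_carr ap_closed ap_proj ap_ap ap_prd assms)

lemma hom_fst: "hom T (prd X Y) X pfst"
  and hom_snd: "hom T (prd X Y) Y psnd"
  unfolding hom_def by (simp_all add: ap_prd)

lemma bihom_pr: "bihom T X Y (prd X Y) pr"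
  unfolding bihom_def by (simp add: ap_prd)

lemma hom_pair: "hom T Z X f \<Longrightarrow> hom T Z Y g \<Longrightarrow> hom T Z (prd X Y) (\<lambda>z. pr (f z) (g z))"
  unfolding hom_def by (simp add: ap_prd)

lemma hom_uncurry: "bihom T X Y Z g \<Longrightarrow> hom T (prd X Y) Z (\<lambda>c. g (pfst c) (psnd c))"
  unfolding hom_def by (simp add: ap_prd bihom_closed bihom_ap)


section \<open>Cartesian closedness in terms of elements\<close>

lemma Mod_simps [simp]:
  "X \<in> Obj (Mod T) \<longleftrightarrow> is_model T X"
  "f \<in> Hom (Mod T) X Y \<longleftrightarrow> f \<in> extensional (carr X) \<and> hom T X Y f"
  "Comp (Mod T) X Y Z g f = compose (carr X) g f"
  "Id (Mod T) X = (\<lambda>x\<in>carr X. x)"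
  by (simp_all add: Mod_def model_homs_iff)

lemma hom_compose: "is_model T X \<Longrightarrow> hom T X Y f \<Longrightarrow> hom T Y Z g \<Longrightarrow> hom T X Z (compose (carr X) g f)"
  unfolding compose_def by (rule hom_restrict[OF _ hom_comp])

lemma compose_ext:
  "f \<in> extensional A \<Longrightarrow> (\<And>x. x \<in> A \<Longrightarrow> g x = f x) \<Longrightarrow> compose A p k = f \<longleftrightarrow> (\<forall>x\<in>A. p (k x) = g x)"
  by (auto simp: compose_def fun_eq_iff extensional_def)

lemma category_Mod: "category (Mod T)"
proof
  fix W X Y Z f g h
  assume "W \<in> Obj (Mod T)" "X \<in> Obj (Mod T)" "Y \<in> Obj (Mod T)" "Z \<in> Obj (Mod T)"
    and "f \<in> Hom (Mod T) W X" "g \<in> Hom (Mod T) X Y" "h \<in> Hom (Mod T) Y Z"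
  then show "Comp (Mod T) W X Z (Comp (Mod T) X Y Z h g) f = Comp (Mod T) W Y Z h (Comp (Mod T) W X Y g f)"
    by (auto simp: compose_def hom_closed)
qed (auto intro: hom_compose[unfolded compose_def] simp: hom_restrict hom_id compose_def fun_eq_iff hom_closed extensional_def)

lemma terminal_Mod: "\<exists>U. terminal (Mod T) U"
proof
  let ?U = "\<lparr>carr = one, interp = (\<lambda>I t x. undefined)\<rparr>"
  have 1: "is_model T ?U"
    unfolding is_model_iff by (simp add: small_one ap_def) (simp add: one_def)
  have 2: "\<exists>!f. f \<in> Hom (Mod T) X ?U" if "is_model T X" for X
  proof
    show "(\<lambda>x\<in>carr X. undefined) \<in> Hom (Mod T) X ?U"
      using that by (auto simp: hom_def one_def ap_closed) (simp add: ap_def)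
  qed (auto simp: hom_def one_def fun_eq_iff extensional_def)
  show "terminal (Mod T) ?U"
    unfolding terminal_def using 1 2 by simp
qed

lemma is_product_Mod:
  "is_product (Mod T) A B P p q \<longleftrightarrow>
     is_model T P \<and> p \<in> extensional (carr P) \<and> hom T P A p \<and> q \<in> extensional (carr P) \<and> hom T P B q \<and>
     (\<forall>Z f g. is_model T Z \<longrightarrow> f \<in> extensional (carr Z) \<longrightarrow> hom T Z A f \<longrightarrow>
        g \<in> extensional (carr Z) \<longrightarrow> hom T Z B g \<longrightarrow>
        (\<exists>!k. k \<in> extensional (carr Z) \<and> hom T Z P k \<and>
            (\<forall>z\<in>carr Z. p (k z) = f z) \<and> (\<forall>z\<in>carr Z. q (k z) = g z)))"
proof -
  have "compose (carr Z) r k = f \<longleftrightarrow> (\<forall>z\<in>carr Z. r (k z) = f z)"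
    if "f \<in> extensional (carr Z)" for r k f :: "'u \<Rightarrow> 'u" and Z :: "'u model"
    using that by (rule compose_ext) simp
  then show ?thesis
    unfolding is_product_def Ball_def Mod_simps
    by (simp add: Ball_def conj_assoc imp_conjL cong: conj_cong)
qed

lemma is_product_prd:
  assumes "is_model T A" "is_model T B"
  shows "is_product (Mod T) A B (prd A B) (restrict pfst (pairs (carr A) (carr B)))
           (restrict psnd (pairs (carr A) (carr B)))" (is "is_product _ _ _ _ ?p ?q")
  unfolding is_product_Mod
proof (intro conjI allI impI)
  show "is_model T (prd A B)" using assms by (rule model_prd)
  then show "hom T (prd A B) A ?p" "hom T (prd A B) B ?q"
    using hom_restrict[OF _ hom_fst] hom_restrict[OF _ hom_snd] by fastforce+
  fix Z f g
  assume Z: "is_model T Z" and f: "hom T Z A f" and g: "hom T Z B g"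
  show "\<exists>!k. k \<in> extensional (carr Z) \<and> hom T Z (prd A B) k \<and>
          (\<forall>z\<in>carr Z. ?p (k z) = f z) \<and> (\<forall>z\<in>carr Z. ?q (k z) = g z)"
  proof (rule ex_ex1I)
    show "\<exists>k. k \<in> extensional (carr Z) \<and> hom T Z (prd A B) k \<and>
          (\<forall>z\<in>carr Z. ?p (k z) = f z) \<and> (\<forall>z\<in>carr Z. ?q (k z) = g z)"
      using hom_restrict[OF Z hom_pair[OF f g]]
      by (intro exI[of _ "\<lambda>z\<in>carr Z. pr (f z) (g z)"])
        (auto simp: hom_closed[OF f] hom_closed[OF g])
    fix k l
    assume k: "k \<in> extensional (carr Z) \<and> hom T Z (prd A B) k \<and>
          (\<forall>z\<in>carr Z. ?p (k z) = f z) \<and> (\<forall>z\<in>carr Z. ?q (k z) = g z)"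
      and l: "l \<in> extensional (carr Z) \<and> hom T Z (prd A B) l \<and>
          (\<forall>z\<in>carr Z. ?p (l z) = f z) \<and> (\<forall>z\<in>carr Z. ?q (l z) = g z)"
    have eq: "m z = pr (f z) (g z)"
      if "hom T Z (prd A B) m" "\<forall>z\<in>carr Z. ?p (m z) = f z" "\<forall>z\<in>carr Z. ?q (m z) = g z" "z \<in> carr Z"
      for m z
      using that hom_closed[OF that(1), of z] by (simp add: in_pairs_iff) metis
    have "k z = l z" if "z \<in> carr Z" for z
      using eq[of k z] eq[of l z] k l that by metis
    then show "k = l"
      using k l by (intro extensionalityI[of k "carr Z" l]) blast+
  qed
qed simp_all

text \<open>Elements of a model are homomorphisms from the free model on one generator.\<close>

lemma is_product_pair:
  assumes P: "is_product (Mod T) A B P p q" and A: "is_model T A" and B: "is_model T B"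
  shows "\<exists>pair. bihom T A B P pair \<and> (\<forall>a\<in>carr A. \<forall>b\<in>carr B. p (pair a b) = a \<and> q (pair a b) = b) \<and>
    (\<forall>z\<in>carr P. pair (p z) (q z) = z)"
proof -
  let ?F = "free T one"
  have PM: "is_model T P" and p: "hom T P A p" and q: "hom T P B q"
    using P unfolding is_product_Mod by auto
  have F: "is_model T ?F" by (rule model_free[OF small_one])
  define el where "el X x = restrict (\<lambda>n. un X n x) (ops T one)" for X :: "'u model" and x
  have el: "el X x \<in> extensional (carr ?F)" "hom T ?F X (el X x)" "el X x (gen T) = x"
    if "is_model T X" "x \<in> carr X" for X x
    using that hom_restrict[OF F hom_eval[OF small_one that(1)], of "\<lambda>_. x"]
    by (simp_all add: el_def un_gen)
  have hel: "r (el P z n) = el X (r z) n" if "hom T P X r" "z \<in> carr P" "n \<in> ops T one" for r X z n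
    using that by (simp add: el_def hom_ap[OF that(1) small_one])
  have un: "\<exists>!k. k \<in> extensional (carr ?F) \<and> hom T ?F P k \<and>
            (\<forall>z\<in>carr ?F. p (k z) = el A a z) \<and> (\<forall>z\<in>carr ?F. q (k z) = el B b z)"
    if "a \<in> carr A" "b \<in> carr B" for a b
    using P F el[OF A that(1)] el[OF B that(2)] unfolding is_product_Mod by blast
  \<comment> \<open>The existence half of the universal property, evaluated at \<open>gen T\<close>,
    yields an element with prescribed components.\<close>
  have ex: "\<exists>z\<in>carr P. p z = a \<and> q z = b" if ab: "a \<in> carr A" "b \<in> carr B" for a b
  proof -
    obtain k where "hom T ?F P k" "\<forall>z\<in>carr ?F. p (k z) = el A a z" "\<forall>z\<in>carr ?F. q (k z) = el B b z"
      using un[OF ab] by blast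
    then show ?thesis
      using el(3) A B ab by (intro bexI[of _ "k (gen T)"]) (auto simp: hom_closed)
  qed
  \<comment> \<open>The uniqueness half: elements with equal components name homomorphisms from
    \<open>free T one\<close> that solve the same factorization problem.\<close>
  have inj: "y = z" if "y \<in> carr P" "z \<in> carr P" "p y = p z" "q y = q z" for y z
  proof -
    let ?Q = "\<lambda>k. k \<in> extensional (carr ?F) \<and> hom T ?F P k \<and>
            (\<forall>n\<in>carr ?F. p (k n) = el A (p z) n) \<and> (\<forall>n\<in>carr ?F. q (k n) = el B (q z) n)"
    have "\<exists>!k. ?Q k"
      by (intro un hom_closed[OF p] hom_closed[OF q] that)
    moreover have "?Q (el P y)" "?Q (el P z)"
      using el(1,2)[OF PM] that by (simp_all add: hel[OF p] hel[OF q])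
    ultimately have "el P y = el P z"
      by blast
    then show ?thesis
      using el(3)[OF PM] that by metis
  qed
  define pair where "pair a b = (SOME z. z \<in> carr P \<and> p z = a \<and> q z = b)" for a b
  have pair: "pair a b \<in> carr P" "p (pair a b) = a" "q (pair a b) = b"
    if "a \<in> carr A" "b \<in> carr B" for a b
    using someI_ex[of "\<lambda>z. z \<in> carr P \<and> p z = a \<and> q z = b"] ex[OF that] unfolding pair_def by auto
  show ?thesis
  proof (intro exI conjI ballI)
    show "bihom T A B P pair"
      unfolding bihom_def
    proof (intro conjI allI impI ballI)
      fix I t w y
      assume I: "small I" "t \<in> ops T I" and wy: "\<forall>i\<in>I. w i \<in> carr A" "\<forall>i\<in>I. y i \<in> carr B"
      then have "ap A I t w \<in> carr A" "ap B I t y \<in> carr B"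
        by (auto intro: ap_closed A B)
      \<comment> \<open>Both sides have the same components, since \<open>p\<close> and
        \<open>q\<close> are homomorphisms.\<close>
      then show "pair (ap A I t w) (ap B I t y) = ap P I t (\<lambda>i. pair (w i) (y i))"
        using wy I by - (rule inj, simp_all add: pair ap_closed PM hom_ap[OF p] hom_ap[OF q])
    qed (rule pair)
    show "pair (p z) (q z) = z" if "z \<in> carr P" for z
      using that by - (rule inj, auto simp: pair hom_closed[OF p] hom_closed[OF q])
  qed (simp_all add: pair)
qed

text \<open>The universal property of an exponential with \<open>bihom\<close> in place of morphisms
  out of a chosen product.\<close>

definition exponent where
  "exponent Y Z E ev \<longleftrightarrow> is_model T E \<and> bihom T E Y Z ev \<and>
     (\<forall>W. is_model T W \<longrightarrow>
        (\<forall>g. bihom T W Y Z g \<longrightarrow>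
           (\<exists>f. hom T W E f \<and> (\<forall>w\<in>carr W. \<forall>y\<in>carr Y. ev (f w) y = g w y))) \<and>
        (\<forall>f f'. hom T W E f \<longrightarrow> hom T W E f' \<longrightarrow>
           (\<forall>w\<in>carr W. \<forall>y\<in>carr Y. ev (f w) y = ev (f' w) y) \<longrightarrow> (\<forall>w\<in>carr W. f w = f' w)))"

lemma exponent_if_is_exponential:
  assumes ex: "is_exponential (Mod T) A B E P p q ev" and A: "is_model T A" and B: "is_model T B"
  shows "\<exists>ev'. exponent A B E ev'"
proof -
  have E: "is_model T E" and P: "is_product (Mod T) E A P p q" and ev: "hom T P B ev"
    using ex unfolding is_exponential_def by simp_all
  have univ: "\<exists>!f. f \<in> Hom (Mod T) Z E \<and> (\<exists>k \<in> Hom (Mod T) Q P.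
              Comp (Mod T) Q P E p k = Comp (Mod T) Q Z E f p' \<and> Comp (Mod T) Q P A q k = q' \<and>
              Comp (Mod T) Q P B ev k = g)"
    if "is_model T Z" "is_product (Mod T) Z A Q p' q'" "g \<in> Hom (Mod T) Q B" for Z Q p' q' g
    using ex that unfolding is_exponential_def Ball_def Mod_simps(1) by blast
  obtain pair where pair: "bihom T E A P pair"
    and pair_proj: "\<forall>a\<in>carr E. \<forall>b\<in>carr A. p (pair a b) = a \<and> q (pair a b) = b"
    and pair_eta: "\<forall>z\<in>carr P. pair (p z) (q z) = z"
    using is_product_pair[OF P E A] by blast
  let ?ev = "\<lambda>e a. ev (pair e a)"
  have bev: "bihom T E A B ?ev"
    using pair ev by (rule bihom_comp)
  have "(\<exists>f. hom T W E f \<and> (\<forall>w\<in>carr W. \<forall>y\<in>carr A. ?ev (f w) y = g w y)) \<and>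
        (\<forall>f f'. hom T W E f \<longrightarrow> hom T W E f' \<longrightarrow> (\<forall>w\<in>carr W. \<forall>y\<in>carr A. ?ev (f w) y = g w y) \<longrightarrow>
           (\<forall>w\<in>carr W. \<forall>y\<in>carr A. ?ev (f' w) y = g w y) \<longrightarrow> (\<forall>w\<in>carr W. f w = f' w))"
    if W: "is_model T W" and g: "bihom T W A B g" for W g
  proof -
    let ?Q = "prd W A"
    let ?p = "restrict pfst (pairs (carr W) (carr A))" and ?q = "restrict psnd (pairs (carr W) (carr A))"
    let ?g = "restrict (\<lambda>c. g (pfst c) (psnd c)) (carr ?Q)"
    let ?R = "\<lambda>f. f \<in> Hom (Mod T) W E \<and> (\<exists>k \<in> Hom (Mod T) ?Q P.
              Comp (Mod T) ?Q P E p k = Comp (Mod T) ?Q W E f ?p \<and> Comp (Mod T) ?Q P A q k = ?q \<and>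
              Comp (Mod T) ?Q P B ev k = ?g)"
    have Q: "is_model T ?Q" by (rule model_prd[OF W A])
    have gh: "?g \<in> Hom (Mod T) ?Q B"
      using hom_restrict[OF Q hom_uncurry[OF g]] by simp
    have un: "\<exists>!f. ?R f"
      by (rule univ[OF W is_product_prd[OF W A] gh])
    \<comment> \<open>At \<open>pr w y\<close> the equations for \<open>k\<close> force the value
      \<open>pair (f w) y\<close>.\<close>
    have 1: "?ev (f w) y = g w y" if r: "?R f" and za: "w \<in> carr W" "y \<in> carr A" for f w y
    proof -
      obtain k where k: "hom T ?Q P k" "compose (carr ?Q) p k = compose (carr ?Q) f ?p"
        "compose (carr ?Q) q k = ?q" "compose (carr ?Q) ev k = ?g"
        using r unfolding Bex_def Mod_simps by blast
      let ?c = "pr w y"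
      have c: "?c \<in> carr ?Q" using that by simp
      have "p (k ?c) = f w" "q (k ?c) = y" "ev (k ?c) = g w y"
        using za c fun_cong[OF k(2), of ?c] fun_cong[OF k(3), of ?c] fun_cong[OF k(4), of ?c]
        by (simp_all add: compose_def)
      then show ?thesis
        using bspec[OF pair_eta hom_closed[OF k(1) c]] by simp
    qed
    \<comment> \<open>Here \<open>k\<close> is the product of \<open>f\<close> with the identity of
      \<open>A\<close>, built from \<open>pair\<close>.\<close>
    have 2: "?R (restrict f (carr W))"
      if f: "hom T W E f" and fg: "\<forall>w\<in>carr W. \<forall>y\<in>carr A. ?ev (f w) y = g w y" for f
    proof -
      let ?k = "restrict (\<lambda>c. pair (f (pfst c)) (psnd c)) (carr ?Q)"
      have "hom T ?Q P ?k"
        by (rule hom_restrict[OF Q hom_uncurry[OF bihom_precomp[OF pair f hom_id]]])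
      then have "?k \<in> Hom (Mod T) ?Q P" by simp
      moreover have "compose (carr ?Q) p ?k = compose (carr ?Q) (restrict f (carr W)) ?p"
        "compose (carr ?Q) q ?k = ?q" "compose (carr ?Q) ev ?k = ?g"
        using fg by (auto simp: compose_def fun_eq_iff pair_proj hom_closed[OF f])
      ultimately show ?thesis
        using hom_restrict[OF W f] by auto
    qed
    obtain f where f: "?R f" using un by blast
    show ?thesis
    proof (intro conjI allI impI ballI)
      have "hom T W E f" using f by simp
      then show "\<exists>f. hom T W E f \<and> (\<forall>w\<in>carr W. \<forall>y\<in>carr A. ?ev (f w) y = g w y)"
        using 1[OF f] by blast
    next
      fix f f' w
      assume "hom T W E f" "hom T W E f'" "\<forall>w\<in>carr W. \<forall>y\<in>carr A. ?ev (f w) y = g w y"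
        "\<forall>w\<in>carr W. \<forall>y\<in>carr A. ?ev (f' w) y = g w y" and w: "w \<in> carr W"
      then have "?R (restrict f (carr W))" "?R (restrict f' (carr W))"
        using 2 by blast+
      with un have "restrict f (carr W) = restrict f' (carr W)" by blast
      then show "f w = f' w" using w by (metis restrict_apply')
    qed
  qed
  note u = this
  have "exponent A B E ?ev"
    unfolding exponent_def
  proof (intro conjI allI impI)
    fix W f f'
    assume W: "is_model T W" and f: "hom T W E f" "hom T W E f'"
      and eq: "\<forall>w\<in>carr W. \<forall>y\<in>carr A. ?ev (f w) y = ?ev (f' w) y"
    show "\<forall>w\<in>carr W. f w = f' w"
      using u[OF W bihom_precomp[OF bev f(2) hom_id]] f eq by blast
  qed (use E bev u in blast)+
  then show ?thesis by blast
qed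

lemma is_exponential_if_exponent:
  assumes ex: "exponent A B E ev" and A: "is_model T A" and B: "is_model T B"
  shows "is_exponential (Mod T) A B E (prd E A) (restrict pfst (pairs (carr E) (carr A)))
    (restrict psnd (pairs (carr E) (carr A)))
    (restrict (\<lambda>c. ev (pfst c) (psnd c)) (pairs (carr E) (carr A)))"
    (is "is_exponential _ _ _ _ ?P ?p ?q ?ev")
proof -
  have E: "is_model T E" and ev: "bihom T E A B ev"
    using ex unfolding exponent_def by auto
  have P: "is_model T ?P" by (rule model_prd[OF E A])
  have "\<exists>!f. f \<in> Hom (Mod T) Z E \<and> (\<exists>k \<in> Hom (Mod T) Q ?P.
              Comp (Mod T) Q ?P E ?p k = Comp (Mod T) Q Z E f p' \<and> Comp (Mod T) Q ?P A ?q k = q' \<and>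
              Comp (Mod T) Q ?P B ?ev k = g)" (is "\<exists>!f. ?R f")
    if Z: "is_model T Z" and Q: "is_product (Mod T) Z A Q p' q'" and g: "g \<in> Hom (Mod T) Q B"
    for Z Q p' q' g
  proof -
    obtain pair where pair: "bihom T Z A Q pair"
      and pair_proj: "\<forall>a\<in>carr Z. \<forall>b\<in>carr A. p' (pair a b) = a \<and> q' (pair a b) = b"
    and pair_eta: "\<forall>z\<in>carr Q. pair (p' z) (q' z) = z"
      using is_product_pair[OF Q Z A] by blast
    have QM: "is_model T Q" and hp: "hom T Q Z p'" and hq: "hom T Q A q'" "q' \<in> extensional (carr Q)"
      using Q unfolding is_product_Mod by auto
    have gh: "hom T Q B g" "g \<in> extensional (carr Q)" using g by auto
    \<comment> \<open>This is the transpose of \<open>g\<close> precomposed with the pairing of the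
      given product \<open>Q\<close>.\<close>
    obtain f where f: "hom T Z E f" and fg: "\<forall>z\<in>carr Z. \<forall>a\<in>carr A. ev (f z) a = g (pair z a)"
      using ex Z bihom_comp[OF pair gh(1)] unfolding exponent_def by meson
    show ?thesis
    proof (rule ex_ex1I)
      let ?k = "restrict (\<lambda>c. pr (f (p' c)) (q' c)) (carr Q)"
      have "hom T Q ?P ?k"
        by (rule hom_restrict[OF QM hom_pair[OF hom_comp[OF hp f] hq(1)]])
      then have "?k \<in> Hom (Mod T) Q ?P" by simp
      moreover have "compose (carr Q) ?p ?k = compose (carr Q) (restrict f (carr Z)) p'"
        "compose (carr Q) ?q ?k = q'" "compose (carr Q) ?ev ?k = g"
        using fg gh(2) hq(2) by (auto simp: compose_def fun_eq_iff pair_eta hom_closed[OF f] hom_closed[OF hp]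
            hom_closed[OF hq(1)] extensional_def)
      ultimately show "\<exists>f. ?R f"
        using hom_restrict[OF Z f] by (intro exI[of _ "restrict f (carr Z)"]) auto
    next
      fix f1 f2
      assume R: "?R f1" "?R f2"
      have *: "ev (f z) a = g (pair z a)" if r: "?R f" and za: "z \<in> carr Z" "a \<in> carr A" for f z a
      proof -
        obtain k where k: "hom T Q ?P k" "compose (carr Q) ?p k = compose (carr Q) f p'"
          "compose (carr Q) ?q k = q'" "compose (carr Q) ?ev k = g"
          using r unfolding Bex_def Mod_simps by blast
        let ?c = "pair z a"
        have c: "?c \<in> carr Q" using bihom_closed[OF pair] that by simp
        show ?thesis
          using za c fun_cong[OF k(2), of ?c] fun_cong[OF k(3), of ?c] fun_cong[OF k(4), of ?c]
            hom_closed[OF k(1) c]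
          by (simp add: compose_def pair_proj)
      qed
      have "\<forall>z\<in>carr Z. \<forall>a\<in>carr A. ev (f1 z) a = ev (f2 z) a"
        using *[OF R(1)] *[OF R(2)] by simp
      then have "\<forall>z\<in>carr Z. f1 z = f2 z"
        using ex Z R unfolding exponent_def Mod_simps by meson
      then show "f1 = f2"
        using R by (intro extensionalityI[of f1 "carr Z" f2]) auto
    qed
  qed
  then show ?thesis
    using E is_product_prd[OF E A] hom_restrict[OF P hom_uncurry[OF ev]]
    unfolding is_exponential_def by simp
qed

text \<open>A terminal object and binary products exist for every theory, so only exponents are at
  issue.\<close>

lemma cartesian_closed_Mod_iff:
  "cartesian_closed (Mod T) \<longleftrightarrow>
     (\<forall>A B. is_model T A \<longrightarrow> is_model T B \<longrightarrow> (\<exists>E ev. exponent A B E ev))"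
proof
  assume "cartesian_closed (Mod T)"
  then show "\<forall>A B. is_model T A \<longrightarrow> is_model T B \<longrightarrow> (\<exists>E ev. exponent A B E ev)"
    unfolding cartesian_closed_def Ball_def Mod_simps using exponent_if_is_exponential by blast
next
  assume "\<forall>A B. is_model T A \<longrightarrow> is_model T B \<longrightarrow> (\<exists>E ev. exponent A B E ev)"
  then show "cartesian_closed (Mod T)"
    unfolding cartesian_closed_def Ball_def Mod_simps
    using category_Mod terminal_Mod is_product_prd is_exponential_if_exponent by blast
qed


section \<open>Hyperaffine operations\<close>

declare small_one [simp] model_free [simp]

lemma affine_iff:
  "affine T I t \<longleftrightarrow> (\<forall>K x. small K \<longrightarrow> x \<in> ops T K \<longrightarrow> ap (free T K) I t (\<lambda>_. x) = x)"
  unfolding affine_def ap_free by blast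

lemma hyperaffine_iff:
  "hyperaffine T I t \<longleftrightarrow> affine T I t \<and>
     (\<forall>K x. small K \<longrightarrow> (\<forall>i\<in>I. \<forall>j\<in>I. x i j \<in> ops T K) \<longrightarrow>
        ap (free T K) I t (\<lambda>i. ap (free T K) I t (x i)) = ap (free T K) I t (\<lambda>i. x i i))"
  unfolding hyperaffine_def ap_free by (simp add: restrict_def)

text \<open>The free model on the carrier of \<open>X\<close> evaluates to \<open>X\<close> by
  sending each generator to the element it names. This transports identities, which are stated for
  free models only, to all models.\<close>

lemma ap_eval:
  assumes "is_model T X" "small I" "t \<in> ops T I" "\<And>i. i \<in> I \<Longrightarrow> x i \<in> carr X"
  shows "ap X (carr X) (ap (free T (carr X)) I t (\<lambda>i. proj T (carr X) (x i))) (\<lambda>x. x) = ap X I t x"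
  using assms small_carr[OF assms(1)] by (simp add: ap_ap ap_proj)

lemma affine_ap:
  assumes "affine T I t" "is_model T X" "small I" "t \<in> ops T I" "x \<in> carr X"
  shows "ap X I t (\<lambda>_. x) = x"
  using assms small_carr[OF assms(2)] ap_eval[OF assms(2-4), of "\<lambda>_. x"]
  by (simp add: affine_iff ap_proj)

lemma hyperaffine_ap:
  assumes t: "hyperaffine T I t" and X: "is_model T X" and I: "small I" "t \<in> ops T I"
    and x: "\<And>i j. i \<in> I \<Longrightarrow> j \<in> I \<Longrightarrow> x i j \<in> carr X"
  shows "ap X I t (\<lambda>i. ap X I t (x i)) = ap X I t (\<lambda>i. x i i)"
proof -
  let ?K = "carr X" let ?F = "free T ?K"
  have K: "small ?K" using X by (rule small_carr)
  have "ap ?F I t (\<lambda>i. ap ?F I t (\<lambda>j. proj T ?K (x i j))) = ap ?F I t (\<lambda>i. proj T ?K (x i i))"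
    using t K x unfolding hyperaffine_iff by simp
  then have "ap X ?K (ap ?F I t (\<lambda>i. ap ?F I t (\<lambda>j. proj T ?K (x i j)))) (\<lambda>x. x)
      = ap X ?K (ap ?F I t (\<lambda>i. proj T ?K (x i i))) (\<lambda>x. x)"
    by simp
  then show ?thesis
    using X K I x by (simp add: ap_ap ap_proj free_ap_closed)
qed

text \<open>The projections are the generic family: substituting any \<open>x\<close> for them
  recovers every instance of the equation.\<close>

lemma decomposes_iff:
  assumes I: "small I" "t \<in> ops T I" "h \<in> ops T I" "m \<in> ops T one"
  shows "decomposes T I t h m \<longleftrightarrow> t = ap (free T I) I h (\<lambda>i. un (free T I) m (proj T I i))"
proof -
  have 1: "decomposes T I t h m \<longleftrightarrow>
    (\<forall>K x. small K \<longrightarrow> (\<forall>i\<in>I. x i \<in> ops T K) \<longrightarrow>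
       ap (free T K) I t x = ap (free T K) I h (\<lambda>i. un (free T K) m (x i)))"
    unfolding decomposes_def app1_def ball_PiE_iff ap_free
    by (simp cong: restrict_cong)
  show ?thesis
  proof
    assume "decomposes T I t h m"
    with 1 have "ap (free T I) I t (proj T I) = ap (free T I) I h (\<lambda>i. un (free T I) m (proj T I i))"
      using I by simp
    then show "t = ap (free T I) I h (\<lambda>i. un (free T I) m (proj T I i))"
      using ap_projs[OF I(1,2)] by simp
  next
    assume t: "t = ap (free T I) I h (\<lambda>i. un (free T I) m (proj T I i))"
    show "decomposes T I t h m"
      unfolding 1 by (subst t) (use I in \<open>simp add: ap_ap ap_proj free_ap_closed\<close>)
  qed
qed

lemma hyperaffine_unary_iff:
  "hyperaffine_unary T \<longleftrightarrow>
     (\<forall>I t. small I \<longrightarrow> t \<in> ops T I \<longrightarrow>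
        (\<exists>!p. fst p \<in> ops T I \<and> hyperaffine T I (fst p) \<and> snd p \<in> ops T one \<and>
           t = ap (free T I) I (fst p) (\<lambda>i. un (free T I) (snd p) (proj T I i))))"
  unfolding hyperaffine_unary_def Ball_def case_prod_beta
  by (simp add: decomposes_iff cong: conj_cong)

text \<open>The diagonal \<open>t(\<lambda>i. x)\<close>. By \<open>dg_decomposition\<close> it is
  the only candidate for the unary part of \<open>t\<close>.\<close>

definition dg :: "'u set \<Rightarrow> 'u \<Rightarrow> 'u" where
  "dg I t = ap (free T one) I t (\<lambda>_. gen T)"

lemma dg_closed [simp]: "small I \<Longrightarrow> t \<in> ops T I \<Longrightarrow> dg I t \<in> ops T one"
  unfolding dg_def by (simp add: free_ap_closed)

text \<open>On the diagonal the affine \<open>h\<close> is applied to a constant family and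
  disappears.\<close>

lemma dg_decomposition:
  assumes "small I" "h \<in> ops T I" "affine T I h" "m \<in> ops T one"
  shows "dg I (ap (free T I) I h (\<lambda>i. un (free T I) m (proj T I i))) = m"
  using assms affine_ap[OF assms(3) _ assms(1,2), of "free T one" m] unfolding dg_def
  by (simp add: ap_ap ap_proj un_free_gen free_ap_closed)


section \<open>Exponents force decompositions\<close>

context
  assumes exps: "\<And>Y Z. is_model T Y \<Longrightarrow> is_model T Z \<Longrightarrow> \<exists>E ev. exponent Y Z E ev"
begin

text \<open>Since products distribute over copowers, \<open>free T I \<times> Y\<close> is the \<open>I\<close>-fold copower of
  \<open>free T one \<times> Y\<close>.\<close>

lemma copower_unique:
  assumes I: "small I" and Y: "is_model T Y" and Z: "is_model T Z"
    and \<theta>: "bihom T (free T I) Y Z \<theta>" "bihom T (free T I) Y Z \<theta>'"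
    and eq: "\<And>i p y. i \<in> I \<Longrightarrow> p \<in> ops T one \<Longrightarrow> y \<in> carr Y \<Longrightarrow>
       \<theta> (un (free T I) p (proj T I i)) y = \<theta>' (un (free T I) p (proj T I i)) y"
    and t: "t \<in> ops T I" and y: "y \<in> carr Y"
  shows "\<theta> t y = \<theta>' t y"
proof -
  let ?F = "free T I"
  obtain E ev where E: "exponent Y Z E ev" using exps[OF Y Z] by blast
  have F: "is_model T ?F" using I by simp
  obtain f where f: "hom T ?F E f" "\<forall>w\<in>carr ?F. \<forall>y\<in>carr Y. ev (f w) y = \<theta> w y"
    using E F \<theta>(1) unfolding exponent_def by meson
  obtain f' where f': "hom T ?F E f'" "\<forall>w\<in>carr ?F. \<forall>y\<in>carr Y. ev (f' w) y = \<theta>' w y"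
    using E F \<theta>(2) unfolding exponent_def by meson
  \<comment> \<open>Restricted along \<open>p \<mapsto> p(\<pi>\<^sub>i)\<close>, both transposes
    become homomorphisms on \<open>free T one\<close> with the same values under \<open>ev\<close>,
    hence equal; \<open>gen T\<close> is mapped to the projection.\<close>
  have proj: "f (proj T I i) = f' (proj T I i)" if i: "i \<in> I" for i
  proof -
    let ?u = "\<lambda>p. un ?F p (proj T I i)"
    have u: "hom T (free T one) ?F ?u"
      using I i by (intro hom_eval) simp_all
    have "\<forall>p\<in>carr (free T one). \<forall>y\<in>carr Y. ev (f (?u p)) y = ev (f' (?u p)) y"
      using f(2) f'(2) eq i hom_closed[OF u] by simp
    then have "\<forall>p\<in>carr (free T one). f (?u p) = f' (?u p)"
      using E model_free[OF small_one] hom_comp[OF u f(1)] hom_comp[OF u f'(1)]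
      unfolding exponent_def by meson
    then show ?thesis
      using un_gen[OF F, of "proj T I i"] I i by (metis carr_free gen_closed proj_closed)
  qed
  \<comment> \<open>Homomorphisms out of a free model that agree on the projections are
    equal.\<close>
  have "f t = f' t"
    using hom_ap[OF f(1) I t, of "proj T I"] hom_ap[OF f'(1) I t, of "proj T I"] I proj
    by (simp add: ap_projs[OF I t])
  then show ?thesis
    using f(2) f'(2) t y by (metis carr_free)
qed

text \<open>Each \<open>g i\<close>, regarded as a map that ignores its first argument, transposes
  to an element of the exponent. These elements extend to a homomorphism from
  \<open>free T I\<close>, and \<open>ev\<close> turns it back into a map out of the
  product.\<close>

lemma copower_exists:
  assumes I: "small I" and Y: "is_model T Y" and Z: "is_model T Z"
    and g: "\<And>i. i \<in> I \<Longrightarrow> hom T Y Z (g i)"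
  obtains \<theta> where "bihom T (free T I) Y Z \<theta>"
    and "\<And>i p y. i \<in> I \<Longrightarrow> p \<in> ops T one \<Longrightarrow> y \<in> carr Y \<Longrightarrow>
       \<theta> (un (free T I) p (proj T I i)) y = g i y"
proof -
  obtain E ev where E: "exponent Y Z E ev" using exps[OF Y Z] by blast
  then have EM: "is_model T E" and ev: "bihom T E Y Z ev" unfolding exponent_def by auto
  have "\<exists>f. hom T (free T one) E f \<and> (\<forall>p\<in>carr (free T one). \<forall>y\<in>carr Y. ev (f p) y = g i y)"
    if "i \<in> I" for i
    using E model_free[OF small_one] bihom_snd[OF g[OF that]] unfolding exponent_def by meson
  then obtain f where f: "\<And>i. i \<in> I \<Longrightarrow> hom T (free T one) E (f i)"
    and fg: "\<And>i p y. i \<in> I \<Longrightarrow> p \<in> ops T one \<Longrightarrow> y \<in> carr Y \<Longrightarrow> ev (f i p) y = g i y"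
    unfolding carr_free by metis
  let ?e = "\<lambda>i. f i (gen T)"
  have e: "?e i \<in> carr E" if "i \<in> I" for i
    using hom_closed[OF f[OF that], of "gen T"] by simp
  show thesis
  proof
    show "bihom T (free T I) Y Z (\<lambda>t y. ev (ap E I t ?e) y)"
      by (rule bihom_precomp[OF ev hom_eval[OF I EM e] hom_id])
    fix i p y assume i: "i \<in> I" and p: "p \<in> ops T one" and y: "y \<in> carr Y"
    \<comment> \<open>Applying \<open>p\<close> to the element \<open>?e i\<close> leaves its values
      under \<open>ev\<close> unchanged, because \<open>f i\<close> transposes a map that ignores
      its first argument.\<close>
    have "ap E I (un (free T I) p (proj T I i)) ?e = un E p (?e i)"
      using I i p EM e by (simp add: ap_ap ap_proj)
    also have "\<dots> = f i (un (free T one) p (gen T))"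
      using hom_ap[OF f[OF i] small_one p, of "\<lambda>_. gen T"] by simp
    also have "\<dots> = f i p"
      using p by (simp add: un_free_gen)
    finally show "ev (ap E I (un (free T I) p (proj T I i)) ?e) y = g i y"
      using fg i p y by simp
  qed
qed

text \<open>The hyperaffine part of \<open>t\<close> is the value at \<open>(t, gen T)\<close> of the homomorphism
  \<open>free T I \<times> free T one \<rightarrow> free T I\<close> that maps \<open>(p(\<pi>\<^sub>i), n)\<close> to \<open>n(\<pi>\<^sub>i)\<close>.\<close>

lemma ex_hyperaffine_part:
  assumes I: "small I"
  obtains hp where "\<And>t. t \<in> ops T I \<Longrightarrow> hp t \<in> ops T I"
    and "\<And>Y Z g. is_model T Y \<Longrightarrow> is_model T Z \<Longrightarrow> (\<And>i. i \<in> I \<Longrightarrow> hom T Y Z (g i)) \<Longrightarrow>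
      bihom T (free T I) Y Z (\<lambda>t y. ap Z I (hp t) (\<lambda>i. g i y))"
    and "\<And>X x i p. is_model T X \<Longrightarrow> (\<And>i. i \<in> I \<Longrightarrow> x i \<in> carr X) \<Longrightarrow> i \<in> I \<Longrightarrow> p \<in> ops T one \<Longrightarrow>
      ap X I (hp (un (free T I) p (proj T I i))) x = x i"
proof -
  let ?F = "free T I" and ?G = "free T one"
  have F: "is_model T ?F" using I by simp
  have "hom T ?G ?F (\<lambda>n. un ?F n (proj T I i))" if "i \<in> I" for i
    using I that by (intro hom_eval) simp_all
  then obtain \<theta> where \<theta>: "bihom T ?F ?G ?F \<theta>"
    and \<theta>p: "\<And>i p n. i \<in> I \<Longrightarrow> p \<in> ops T one \<Longrightarrow> n \<in> ops T one \<Longrightarrow>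
      \<theta> (un ?F p (proj T I i)) n = un ?F n (proj T I i)"
    using copower_exists[OF I model_free[OF small_one] F, of "\<lambda>i n. un ?F n (proj T I i)"]
    unfolding carr_free by metis
  let ?hp = "\<lambda>t. \<theta> t (gen T)"
  have hp: "?hp t \<in> ops T I" if "t \<in> ops T I" for t
    using bihom_closed[OF \<theta>, of t "gen T"] that by simp
  show thesis
  proof
    show "?hp t \<in> ops T I" if "t \<in> ops T I" for t using that by (rule hp)
    show "ap X I (?hp (un ?F p (proj T I i))) x = x i"
      if "is_model T X" "\<And>i. i \<in> I \<Longrightarrow> x i \<in> carr X" "i \<in> I" "p \<in> ops T one" for X x i p
      using that I un_gen[OF F, of "proj T I i"] by (simp add: \<theta>p ap_proj)
    show "bihom T ?F Y Z (\<lambda>t y. ap Z I (?hp t) (\<lambda>i. g i y))"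
      if Y: "is_model T Y" and Z: "is_model T Z" and g: "\<And>i. i \<in> I \<Longrightarrow> hom T Y Z (g i)" for Y Z g
    proof -
      \<comment> \<open>The copairing of the \<open>g i\<close> is a homomorphism on the product by
        construction; the map in question will be shown equal to it.\<close>
      obtain \<phi> where \<phi>: "bihom T ?F Y Z \<phi>" and \<phi>p: "\<And>i p y. i \<in> I \<Longrightarrow> p \<in> ops T one \<Longrightarrow>
          y \<in> carr Y \<Longrightarrow> \<phi> (un ?F p (proj T I i)) y = g i y"
        using copower_exists[OF I Y Z, of g] g by blast
      have eq: "\<phi> t y = ap Z I (?hp t) (\<lambda>i. g i y)" if t: "t \<in> ops T I" and y: "y \<in> carr Y" for t y
      proof -
        have gy: "g i y \<in> carr Z" if "i \<in> I" for i using hom_closed[OF g[OF that] y] .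
        have un: "un Y n y \<in> carr Y" if "n \<in> ops T one" for n
          using Y y that by (simp add: ap_closed)
        \<comment> \<open>With \<open>y\<close> fixed, \<open>gen T\<close> is replaced by a
          variable \<open>n\<close>. Both sides are then homomorphisms on
          \<open>free T I \<times> free T one\<close>, and on the \<open>i\<close>-th summand both
          give \<open>n(g\<^sub>i(y)) = g\<^sub>i(n(y))\<close>.\<close>
        have "\<phi> t (un Y (gen T) y) = ap Z I (\<theta> t (gen T)) (\<lambda>i. g i y)"
        proof (rule copower_unique[OF I model_free[OF small_one] Z,
              where \<theta> = "\<lambda>t n. \<phi> t (un Y n y)" and \<theta>' = "\<lambda>t n. ap Z I (\<theta> t n) (\<lambda>i. g i y)"])
          show "bihom T ?F ?G Z (\<lambda>t n. \<phi> t (un Y n y))"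
            by (rule bihom_precomp[OF \<phi> hom_id hom_eval[OF small_one Y y]])
          show "bihom T ?F ?G Z (\<lambda>t n. ap Z I (\<theta> t n) (\<lambda>i. g i y))"
            by (rule bihom_comp[OF \<theta> hom_eval[OF I Z gy]])
          show "\<phi> (un ?F p (proj T I i)) (un Y n y) = ap Z I (\<theta> (un ?F p (proj T I i)) n) (\<lambda>i. g i y)"
            if "i \<in> I" "p \<in> ops T one" "n \<in> carr ?G" for i p n
            using that I Z gy y un hom_ap[OF g[OF that(1)] small_one, of n "\<lambda>_. y"]
            by (simp add: \<phi>p \<theta>p ap_ap ap_proj)
        qed (use t in simp_all)
        then show ?thesis using un_gen[OF Y y] by simp
      qed
      show ?thesis
        unfolding bihom_def
      proof (intro conjI allI impI ballI)
        fix t y assume "t \<in> carr ?F" "y \<in> carr Y"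
        then show "ap Z I (?hp t) (\<lambda>i. g i y) \<in> carr Z"
          using eq bihom_closed[OF \<phi>] by fastforce
      next
        fix J s t y
        assume J: "small J" "s \<in> ops T J" and ty: "\<forall>j\<in>J. t j \<in> carr ?F" "\<forall>j\<in>J. y j \<in> carr Y"
        then have "ap Y J s y \<in> carr Y" "ap ?F J s t \<in> ops T I"
          using Y I by (auto intro!: ap_closed free_ap_closed)
        then show "ap Z I (?hp (ap ?F J s t)) (\<lambda>i. g i (ap Y J s y))
            = ap Z J s (\<lambda>j. ap Z I (?hp (t j)) (\<lambda>i. g i (y j)))"
          using bihom_ap[OF \<phi> J, of t y] ty by (simp add: eq)
      qed
    qed
  qed
qed

lemma hyperaffine_unary_if_exponents: "hyperaffine_unary T"
  unfolding hyperaffine_unary_iff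
proof (intro allI impI)
  fix I t assume I: "small I" and t: "t \<in> ops T I"
  let ?F = "free T I" and ?G = "free T one"
  have F: "is_model T ?F" using I by simp
  obtain hp where hp: "\<And>t. t \<in> ops T I \<Longrightarrow> hp t \<in> ops T I"
    and bi: "\<And>Y Z g. is_model T Y \<Longrightarrow> is_model T Z \<Longrightarrow> (\<And>i. i \<in> I \<Longrightarrow> hom T Y Z (g i)) \<Longrightarrow>
      bihom T ?F Y Z (\<lambda>t y. ap Z I (hp t) (\<lambda>i. g i y))"
    and hp_un: "\<And>X x i p. is_model T X \<Longrightarrow> (\<And>i. i \<in> I \<Longrightarrow> x i \<in> carr X) \<Longrightarrow> i \<in> I \<Longrightarrow> p \<in> ops T one \<Longrightarrow>
      ap X I (hp (un ?F p (proj T I i))) x = x i"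
    using ex_hyperaffine_part[OF I] by blast
  \<comment> \<open>With all \<open>g i\<close> the identity, the map agrees on the summands with
    the second projection.\<close>
  have aff: "ap X I (hp t) (\<lambda>_. x) = x" if "is_model T X" "x \<in> carr X" "t \<in> ops T I" for X x t
    by (rule copower_unique[where t = t and y = x,
          OF I that(1) that(1) bi[OF that(1) that(1) hom_id] bihom_snd[OF hom_id]])
      (use that hp_un in auto)
  have hyp: "ap X I (hp t) (\<lambda>i. ap X I (hp t) (x i)) = ap X I (hp t) (\<lambda>i. x i i)"
    if X: "is_model T X" and x: "\<And>i j. i \<in> I \<Longrightarrow> j \<in> I \<Longrightarrow> x i j \<in> carr X" for X x
  proof -
    have hx: "hom T ?F X (\<lambda>u. ap X I u (x i))" if "i \<in> I" for i
      using x that by (intro hom_eval I X) auto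
    have 1: "bihom T ?F ?F X (\<lambda>t u. ap X I (hp t) (\<lambda>i. ap X I u (x i)))"
      by (rule bi[OF F X hx])
    have h1: "hom T ?G ?F (\<lambda>n. un ?F n (proj T I i))" if "i \<in> I" for i
      using I that by (intro hom_eval) simp_all
    have 2: "bihom T ?F ?G ?F (\<lambda>t n. ap ?F I (hp t) (\<lambda>i. un ?F n (proj T I i)))" (is "bihom T _ _ _ ?\<theta>")
      by (rule bi[OF model_free[OF small_one] F h1])
    \<comment> \<open>Again \<open>gen T\<close> is generalized to \<open>n\<close>, so that both
      sides are homomorphisms in \<open>(t, n)\<close>; on the \<open>i\<close>-th summand each
      reduces to \<open>n(x\<^sub>i\<^sub>i)\<close>.\<close>
    have "ap X I (hp t) (\<lambda>i. ap X I (?\<theta> t (gen T)) (x i)) = ap X I (?\<theta> t (gen T)) (\<lambda>i. x i i)"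
    proof (rule copower_unique[OF I model_free[OF small_one] X,
          where \<theta> = "\<lambda>t n. ap X I (hp t) (\<lambda>i. ap X I (?\<theta> t n) (x i))"
            and \<theta>' = "\<lambda>t n. ap X I (?\<theta> t n) (\<lambda>i. x i i)"])
      show "bihom T ?F ?G X (\<lambda>t n. ap X I (hp t) (\<lambda>i. ap X I (?\<theta> t n) (x i)))"
        by (rule bihom_diag[OF 1 2])
      show "bihom T ?F ?G X (\<lambda>t n. ap X I (?\<theta> t n) (\<lambda>i. x i i))"
        using x by (intro bihom_comp[OF 2] hom_eval I X) auto
      show "ap X I (hp (un ?F p (proj T I i))) (\<lambda>k. ap X I (?\<theta> (un ?F p (proj T I i)) n) (x k)) =
          ap X I (?\<theta> (un ?F p (proj T I i)) n) (\<lambda>i. x i i)"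
        if "i \<in> I" "p \<in> ops T one" "n \<in> carr ?G" for i p n
      proof -
        have "?\<theta> (un ?F p (proj T I i)) n = un ?F n (proj T I i)"
          using that I F by (intro hp_un) (auto simp: free_ap_closed)
        then show ?thesis
          using that I X x hp_un[OF X, of "\<lambda>k. ap X I (un ?F n (proj T I i)) (x k)" i p]
          by (simp add: ap_ap ap_proj ap_closed)
      qed
    qed (use t in simp_all)
    moreover have "?\<theta> t (gen T) = hp t"
      using I F hp[OF t] by (simp add: un_gen ap_projs cong: ap_cong)
    ultimately show ?thesis by simp
  qed
  have bd: "bihom T ?F ?G ?F (\<lambda>t n. ap ?F I (hp t) (\<lambda>i. un ?F n (proj T I i)))"
    using I by (intro bi F hom_eval) simp_all
  have decomp: "t = ap ?F I (hp t) (\<lambda>i. un ?F (dg I t) (proj T I i))"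
  proof -
    \<comment> \<open>The pair of \<open>t\<close> and its diagonal is the operation
      \<open>t\<close> applied in the product to the pairs \<open>(\<pi>\<^sub>j, gen T)\<close>,
      and each of these is mapped to \<open>\<pi>\<^sub>j\<close>.\<close>
    have "ap ?F I (hp (ap ?F I t (proj T I))) (\<lambda>i. un ?F (ap ?G I t (\<lambda>_. gen T)) (proj T I i))
      = ap ?F I t (\<lambda>j. ap ?F I (hp (proj T I j)) (\<lambda>i. un ?F (gen T) (proj T I i)))"
      using I t by (intro bihom_ap[OF bd]) simp_all
    also have "\<dots> = ap ?F I t (proj T I)"
    proof (rule ap_eqI)
      fix j assume j: "j \<in> I"
      then show "ap ?F I (hp (proj T I j)) (\<lambda>i. un ?F (gen T) (proj T I i)) = proj T I j"
        using I F hp_un[OF F, of "proj T I" j "gen T"] by (simp add: un_gen)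
    qed
    finally show ?thesis
      using I t by (simp add: ap_projs dg_def)
  qed
  show "\<exists>!p. fst p \<in> ops T I \<and> hyperaffine T I (fst p) \<and> snd p \<in> ops T one \<and>
           t = ap ?F I (fst p) (\<lambda>i. un ?F (snd p) (proj T I i))"
  proof (rule ex1I[of _ "(hp t, dg I t)"])
    show "fst (hp t, dg I t) \<in> ops T I \<and> hyperaffine T I (fst (hp t, dg I t)) \<and> snd (hp t, dg I t) \<in> ops T one \<and>
           t = ap ?F I (fst (hp t, dg I t)) (\<lambda>i. un ?F (snd (hp t, dg I t)) (proj T I i))"
      unfolding fst_conv snd_conv hyperaffine_iff affine_iff
      using I t hp aff hyp decomp by auto
  next
    fix p assume "fst p \<in> ops T I \<and> hyperaffine T I (fst p) \<and> snd p \<in> ops T one \<and>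
           t = ap ?F I (fst p) (\<lambda>i. un ?F (snd p) (proj T I i))"
    then obtain h m where p: "p = (h, m)" and h: "h \<in> ops T I" "affine T I h" and m: "m \<in> ops T one"
      and th: "t = ap ?F I h (\<lambda>i. un ?F m (proj T I i))"
      unfolding hyperaffine_iff by (cases p) auto
    have "dg I t = m"
      unfolding th using I h m by (intro dg_decomposition)
    moreover have "hp t = h"
    proof -
      \<comment> \<open>Since \<open>h\<close> is affine, \<open>gen T\<close> is \<open>h\<close>
        of a constant family. So \<open>(t, gen T)\<close> is \<open>h\<close> applied to the pairs
        \<open>(m(\<pi>\<^sub>j), gen T)\<close>, whose images are the projections.\<close>
      have "hp t = ap ?F I (hp t) (\<lambda>i. un ?F (gen T) (proj T I i))"
        using I F hp[OF t] by (simp add: un_gen ap_projs)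
      also have "gen T = ap ?G I h (\<lambda>_. gen T)"
        using affine_ap[OF h(2) _ I h(1), of ?G "gen T"] by simp
      also have "ap ?F I (hp t) (\<lambda>i. un ?F (ap ?G I h (\<lambda>_. gen T)) (proj T I i)) =
          ap ?F I h (\<lambda>j. ap ?F I (hp (un ?F m (proj T I j))) (\<lambda>i. un ?F (gen T) (proj T I i)))"
        unfolding th using I h m by (intro bihom_ap[OF bd]) (simp_all add: free_ap_closed)
      also have "\<dots> = ap ?F I h (proj T I)"
        using I F m by (intro ap_eqI) (simp add: un_gen hp_un)
      finally show ?thesis using I h by (simp add: ap_projs)
    qed
    ultimately show "p = (hp t, dg I t)" using p by simp
  qed
qed

end


section \<open>Exponents from decompositions\<close>

text \<open>The case \<open>W = free T one\<close> supplies the carrier of the exponent: elements of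
  \<open>S\<close> are codes of homomorphisms on the product, and \<open>cur\<close> decodes them in
  curried form. Smallness holds because these are functions between small carriers.\<close>

lemma ex_hom_object:
  assumes W: "is_model T W" and Y: "is_model T Y" and Z: "is_model T Z"
  shows "\<exists>S cur. small (S :: 'u set) \<and> (\<forall>e\<in>S. bihom T W Y Z (cur e)) \<and>
    (\<forall>e\<in>S. \<forall>e'\<in>S. (\<forall>w\<in>carr W. \<forall>y\<in>carr Y. cur e w y = cur e' w y) \<longrightarrow> e = e') \<and>
    (\<forall>\<phi>. bihom T W Y Z \<phi> \<longrightarrow> (\<exists>e\<in>S. \<forall>w\<in>carr W. \<forall>y\<in>carr Y. cur e w y = \<phi> w y))"
proof -
  let ?P = "prd W Y"
  let ?H = "model_homs T ?P Z"
  have P: "is_model T ?P" using W Y by (rule model_prd)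
  have "?H \<subseteq> carr ?P \<rightarrow>\<^sub>E carr Z"
    unfolding model_homs_def by blast
  then have "|?H| <o |UNIV :: 'u set|"
    using card_funcset_less[OF small_carr[OF P] small_carr[OF Z]] card_of_mono1 ordLeq_ordLess_trans
    by blast
  then obtain enc :: "('u \<Rightarrow> 'u) \<Rightarrow> 'u" where enc: "inj_on enc ?H" "small (enc ` ?H)"
    by (rule ex_small_encoding)
  let ?cur = "\<lambda>e w y. inv_into ?H enc e (pr w y)"
  show ?thesis
  proof (intro exI[of _ "enc ` ?H"] exI[of _ ?cur] conjI ballI allI impI)
    show "small (enc ` ?H)" by (rule enc)
    show "bihom T W Y Z (?cur e)" if "e \<in> enc ` ?H" for e
    proof -
      have "hom T ?P Z (inv_into ?H enc e)"
        using inv_into_into[OF that] unfolding model_homs_iff by simp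
      then show ?thesis by (rule bihom_comp[OF bihom_pr])
    qed
    show "e = e'" if e: "e \<in> enc ` ?H" "e' \<in> enc ` ?H"
      and eq: "\<forall>w\<in>carr W. \<forall>y\<in>carr Y. ?cur e w y = ?cur e' w y" for e e'
    proof -
      have "inv_into ?H enc e c = inv_into ?H enc e' c" if "c \<in> carr ?P" for c
        using bspec[OF bspec[OF eq, of "pfst c"], of "psnd c"] that by simp
      then have "inv_into ?H enc e = inv_into ?H enc e'"
        using inv_into_into[OF e(1)] inv_into_into[OF e(2)] unfolding model_homs_iff
        by (meson extensionalityI)
      then show ?thesis using e by (metis f_inv_into_f)
    qed
    show "\<exists>e\<in>enc ` ?H. \<forall>w\<in>carr W. \<forall>y\<in>carr Y. ?cur e w y = \<phi> w y" if "bihom T W Y Z \<phi>" for \<phi>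
    proof -
      let ?f = "restrict (\<lambda>c. \<phi> (pfst c) (psnd c)) (carr ?P)"
      have "?f \<in> ?H"
        unfolding model_homs_iff using hom_restrict[OF P hom_uncurry[OF that]] by simp
      then show ?thesis
        using inv_into_f_f[OF enc(1)] by (intro bexI[of _ "enc ?f"]) auto
    qed
  qed
qed

context
  assumes hu: "hyperaffine_unary T"
begin

text \<open>The unary part is already known to be \<open>dg I t\<close>, so only the hyperaffine
  part is chosen.\<close>

definition hy :: "'u set \<Rightarrow> 'u \<Rightarrow> 'u" where
  "hy I t = (SOME h. h \<in> ops T I \<and> hyperaffine T I h \<and>
     t = ap (free T I) I h (\<lambda>i. un (free T I) (dg I t) (proj T I i)))"

lemma hy:
  assumes I: "small I" and t: "t \<in> ops T I"
  shows hy_closed: "hy I t \<in> ops T I" and hyperaffine_hy: "hyperaffine T I (hy I t)"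
    and hy_decomposition: "t = ap (free T I) I (hy I t) (\<lambda>i. un (free T I) (dg I t) (proj T I i))"
proof -
  obtain h m where h: "h \<in> ops T I" "hyperaffine T I h" and m: "m \<in> ops T one"
      and th: "t = ap (free T I) I h (\<lambda>i. un (free T I) m (proj T I i))"
    using hu I t unfolding hyperaffine_unary_iff by blast
  have "dg I t = m"
    unfolding th using h I m by (intro dg_decomposition) (auto simp: hyperaffine_iff)
  with th have "t = ap (free T I) I h (\<lambda>i. un (free T I) (dg I t) (proj T I i))"
    by simp
  with h have "\<exists>h. h \<in> ops T I \<and> hyperaffine T I h \<and>
     t = ap (free T I) I h (\<lambda>i. un (free T I) (dg I t) (proj T I i))"
    by (intro exI conjI)
  then have "hy I t \<in> ops T I \<and> hyperaffine T I (hy I t) \<and>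
     t = ap (free T I) I (hy I t) (\<lambda>i. un (free T I) (dg I t) (proj T I i))"
    unfolding hy_def by (rule someI_ex)
  then show "hy I t \<in> ops T I" "hyperaffine T I (hy I t)"
    "t = ap (free T I) I (hy I t) (\<lambda>i. un (free T I) (dg I t) (proj T I i))"
    by - (elim conjE, assumption)+
qed

declare hy_closed [simp]

lemma affine_hy: "small I \<Longrightarrow> t \<in> ops T I \<Longrightarrow> affine T I (hy I t)"
  using hyperaffine_hy by (simp add: hyperaffine_iff)

lemma ap_hy:
  assumes "is_model T X" "small I" "t \<in> ops T I" "\<And>i. i \<in> I \<Longrightarrow> x i \<in> carr X"
  shows "ap X I t x = ap X I (hy I t) (\<lambda>i. un X (dg I t) (x i))"
proof -
  have "ap X I t x = ap X I (ap (free T I) I (hy I t) (\<lambda>i. un (free T I) (dg I t) (proj T I i))) x"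
    using hy_decomposition assms by simp
  also have "\<dots> = ap X I (hy I t) (\<lambda>i. un X (dg I t) (x i))"
    using assms by (simp add: ap_ap ap_proj free_ap_closed)
  finally show ?thesis .
qed

text \<open>The unary part of an affine operation is the identity.\<close>

lemma affine_imp_hyperaffine:
  assumes I: "small I" and h: "h \<in> ops T I" "affine T I h"
  shows "hyperaffine T I h"
proof -
  have "dg I h = gen T"
    unfolding dg_def using affine_ap[OF h(2) _ I h(1), of "free T one" "gen T"] by simp
  then have "h = ap (free T I) I (hy I h) (\<lambda>i. un (free T I) (gen T) (proj T I i))"
    using hy_decomposition[OF I h(1)] by simp
  also have "\<dots> = ap (free T I) I (hy I h) (proj T I)"
    using I by (intro ap_eqI) (simp add: un_gen)
  also have "\<dots> = hy I h"
    using I h by (simp add: ap_projs)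
  finally show ?thesis
    using hyperaffine_hy[OF I h(1)] by simp
qed

text \<open>Affineness of \<open>h\<close> suffices, by \<open>affine_imp_hyperaffine\<close>; in
  the applications it is much easier to check than hyperaffineness.\<close>

lemma hy_unique:
  assumes I: "small I" and h: "h \<in> ops T I" "affine T I h" and m: "m \<in> ops T one"
    and t: "t = ap (free T I) I h (\<lambda>i. un (free T I) m (proj T I i))"
  shows "hy I t = h"
proof -
  have tI: "t \<in> ops T I"
    unfolding t using I h m by (simp add: free_ap_closed)
  let ?Q = "\<lambda>p. fst p \<in> ops T I \<and> hyperaffine T I (fst p) \<and> snd p \<in> ops T one \<and>
           t = ap (free T I) I (fst p) (\<lambda>i. un (free T I) (snd p) (proj T I i))"
  have "\<exists>!p. ?Q p"
    using hu I tI unfolding hyperaffine_unary_iff by blast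
  moreover have "?Q (h, m)"
    unfolding fst_conv snd_conv using h m affine_imp_hyperaffine[OF I h] t by blast
  moreover have "?Q (hy I t, dg I t)"
    unfolding fst_conv snd_conv using hy[OF I tI] dg_closed[OF I tI] by blast
  ultimately have "(hy I t, dg I t) = (h, m)" by blast
  then show ?thesis by simp
qed

text \<open>Both \<open>k\<close> and the hyperaffine part of \<open>s\<close> are marginals of one hyperaffine operation of arity \<open>I \<times> J\<close>.\<close>

lemma swap_affine:
  assumes I: "small I" and J: "small J" and s: "s \<in> ops T J"
    and h: "\<And>j. j \<in> J \<Longrightarrow> h j \<in> ops T I" "\<And>j. j \<in> J \<Longrightarrow> affine T I (h j)"
  obtains k where "k \<in> ops T I" "affine T I k"
    and "\<And>X x. is_model T X \<Longrightarrow> (\<And>i j. i \<in> I \<Longrightarrow> j \<in> J \<Longrightarrow> x j i \<in> carr X) \<Longrightarrow>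
      ap X J s (\<lambda>j. ap X I (h j) (x j)) = ap X I k (\<lambda>i. ap X J s (\<lambda>j. x j i))"
proof -
  define K where "K = pairs I J"
  have K: "small K" unfolding K_def using I J by (rule small_pairs)
  have Kp: "\<forall>p\<in>K. pfst p \<in> I" "\<forall>p\<in>K. psnd p \<in> J" unfolding K_def by auto
  have pK: "pr i j \<in> K" if "i \<in> I" "j \<in> J" for i j using that unfolding K_def by simp
  define t where "t = ap (free T K) J s (\<lambda>j. ap (free T K) I (h j) (\<lambda>i. proj T K (pr i j)))"
  have t: "t \<in> ops T K"
    unfolding t_def using I J K s h pK by (simp add: free_ap_closed)
  have ap_t: "ap X K t z = ap X J s (\<lambda>j. ap X I (h j) (\<lambda>i. z (pr i j)))"
    if "is_model T X" "\<And>p. p \<in> K \<Longrightarrow> z p \<in> carr X" for X z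
    unfolding t_def using that I J K s h pK by (simp add: ap_ap ap_proj free_ap_closed)
  define g where "g = hy K t"
  have g: "g \<in> ops T K" "hyperaffine T K g" "affine T K g"
    unfolding g_def using K t by (simp_all add: hyperaffine_hy affine_hy)
  \<comment> \<open>Each \<open>h j\<close> is affine, so on constant families \<open>t\<close>
    agrees with \<open>s\<close>.\<close>
  have dg: "dg K t = dg J s"
    unfolding dg_def using I J s h by (simp add: ap_t affine_ap)
  have ap_g: "ap X K g (\<lambda>p. un X (dg J s) (z p)) = ap X J s (\<lambda>j. ap X I (h j) (\<lambda>i. z (pr i j)))"
    if "is_model T X" "\<And>p. p \<in> K \<Longrightarrow> z p \<in> carr X" for X z
    using ap_hy[of X K t z] ap_t[of X z] K t that by (simp add: g_def dg)
  \<comment> \<open>Reindexing \<open>g\<close> along any map \<open>r\<close> keeps it affine;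
    \<open>k\<close> and \<open>l\<close> are the cases of the two coordinates.\<close>
  have marg: "ap (free T L) K g (\<lambda>p. proj T L (r p)) \<in> ops T L"
    "affine T L (ap (free T L) K g (\<lambda>p. proj T L (r p)))"
    "\<And>X x. is_model T X \<Longrightarrow> (\<And>l. l \<in> L \<Longrightarrow> x l \<in> carr X) \<Longrightarrow>
      ap X L (ap (free T L) K g (\<lambda>p. proj T L (r p))) x = ap X K g (\<lambda>p. x (r p))"
    if L: "small L" and r: "\<forall>p\<in>K. r p \<in> L" for L r
    using K g L r unfolding affine_iff
    by (auto simp: free_ap_closed ap_ap ap_proj affine_ap[OF g(3)])
  define k where "k = ap (free T I) K g (\<lambda>p. proj T I (pfst p))"
  define l where "l = ap (free T J) K g (\<lambda>p. proj T J (psnd p))"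
  note mk = marg[OF I Kp(1), folded k_def]
  note ml = marg[OF J Kp(2), folded l_def]
  \<comment> \<open>When the argument depends on \<open>j\<close> only, the affine
    \<open>h j\<close> collapse, and the decomposition of \<open>t\<close> becomes one of
    \<open>s\<close> with hyperaffine part \<open>l\<close>.\<close>
  have "s = ap (free T J) J l (\<lambda>j. un (free T J) (dg J s) (proj T J j))"
  proof -
    have "ap (free T J) J l (\<lambda>j. un (free T J) (dg J s) (proj T J j))
        = ap (free T J) K g (\<lambda>p. un (free T J) (dg J s) (proj T J (psnd p)))"
      using J s by (intro ml(3)) (simp_all add: free_ap_closed)
    also have "\<dots> = ap (free T J) J s (\<lambda>j. ap (free T J) I (h j) (\<lambda>i. proj T J j))"
      using ap_g[of "free T J" "\<lambda>p. proj T J (psnd p)"] J Kp by simp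
    also have "\<dots> = ap (free T J) J s (proj T J)"
      using I J h by (intro ap_eqI) (simp add: affine_ap)
    finally show ?thesis using J s by (simp add: ap_projs)
  qed
  then have l: "hy J s = l"
    using J s ml(1,2) by (intro hy_unique) simp_all
  show thesis
  proof
    show "k \<in> ops T I" "affine T I k" using mk by simp_all
    fix X x assume X: "is_model T X" and x: "\<And>i j. i \<in> I \<Longrightarrow> j \<in> J \<Longrightarrow> x j i \<in> carr X"
    let ?u = "\<lambda>j i. un X (dg J s) (x j i)"
    have u: "?u j i \<in> carr X" if "i \<in> I" "j \<in> J" for i j
      using X x that J s by (simp add: ap_closed)
    have "ap X I k (\<lambda>i. ap X J s (\<lambda>j. x j i)) = ap X K g (\<lambda>p. ap X J s (\<lambda>j. x j (pfst p)))"
      using X J s x by (intro mk(3)) (simp_all add: ap_closed)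
    also have "\<dots> = ap X K g (\<lambda>p. ap X K g (\<lambda>q. ?u (psnd q) (pfst p)))"
    proof (rule ap_eqI)
      fix p assume p: "p \<in> K"
      have "ap X J s (\<lambda>j. x j (pfst p)) = ap X J l (\<lambda>j. ?u j (pfst p))"
        using X J s x Kp p l by (subst ap_hy) simp_all
      also have "\<dots> = ap X K g (\<lambda>q. ?u (psnd q) (pfst p))"
        using X u Kp p by (intro ml(3)) simp_all
      finally show "ap X J s (\<lambda>j. x j (pfst p)) = ap X K g (\<lambda>q. ?u (psnd q) (pfst p))" .
    qed
    \<comment> \<open>Both occurrences of \<open>g\<close>, one from \<open>k\<close> and one from
      \<open>l\<close>, merge by hyperaffineness.\<close>
    also have "\<dots> = ap X K g (\<lambda>p. ?u (psnd p) (pfst p))"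
      using g K X u Kp by (intro hyperaffine_ap) simp_all
    also have "\<dots> = ap X J s (\<lambda>j. ap X I (h j) (x j))"
      using ap_g[OF X, of "\<lambda>p. x (psnd p) (pfst p)"] x Kp by simp
    finally show "ap X J s (\<lambda>j. ap X I (h j) (x j)) = ap X I k (\<lambda>i. ap X J s (\<lambda>j. x j i))" by simp
  qed
qed

text \<open>This identifies the \<open>k\<close> of the exchange law. Moving the hyperaffine parts
  of the \<open>t j\<close> out of \<open>s\<close> leaves the single unary operation
  \<open>s(\<lambda>j. m\<^sub>j)\<close> under \<open>k\<close>, where \<open>m\<^sub>j\<close> is
  the unary part of \<open>t j\<close>. So \<open>k\<close> is the hyperaffine part of the
  composite.\<close>

lemma ap_hy_sub:
  assumes I: "small I" and J: "small J" and s: "s \<in> ops T J" and t: "\<And>j. j \<in> J \<Longrightarrow> t j \<in> ops T I"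
    and X: "is_model T X" and b: "\<And>i j. i \<in> I \<Longrightarrow> j \<in> J \<Longrightarrow> b j i \<in> carr X"
  shows "ap X I (hy I (ap (free T I) J s t)) (\<lambda>i. ap X J s (\<lambda>j. b j i))
    = ap X J s (\<lambda>j. ap X I (hy I (t j)) (b j))"
proof -
  let ?F = "free T I"
  have F: "is_model T ?F" using I by simp
  show ?thesis
  proof (rule swap_affine[OF I J s, where h = "\<lambda>j. hy I (t j)"])
    show "hy I (t j) \<in> ops T I" "affine T I (hy I (t j))" if "j \<in> J" for j
      using I t[OF that] by (simp_all add: affine_hy)
    fix k assume k: "k \<in> ops T I" "affine T I k"
      and swap: "\<And>X x. is_model T X \<Longrightarrow> (\<And>i j. i \<in> I \<Longrightarrow> j \<in> J \<Longrightarrow> x j i \<in> carr X) \<Longrightarrow>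
        ap X J s (\<lambda>j. ap X I (hy I (t j)) (x j)) = ap X I k (\<lambda>i. ap X J s (\<lambda>j. x j i))"
    let ?m = "ap (free T one) J s (\<lambda>j. dg I (t j))"
    have m: "?m \<in> ops T one" using I J s t by (simp add: free_ap_closed)
    have "ap ?F J s t = ap ?F J s (\<lambda>j. ap ?F I (hy I (t j)) (\<lambda>i. un ?F (dg I (t j)) (proj T I i)))"
      using hy_decomposition[OF I t] by (rule ap_eqI)
    also have "\<dots> = ap ?F I k (\<lambda>i. ap ?F J s (\<lambda>j. un ?F (dg I (t j)) (proj T I i)))"
      using I t by (intro swap F) (simp add: free_ap_closed)
    also have "\<dots> = ap ?F I k (\<lambda>i. un ?F ?m (proj T I i))"
      using I J s t by (simp add: ap_ap)
    finally have "hy I (ap ?F J s t) = k"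
      using I k m by (intro hy_unique)
    then show ?thesis using swap[OF X b] by simp
  qed
qed


context
  fixes A B
  assumes A: "is_model T A" and B: "is_model T B"
begin

text \<open>An element \<open>e\<close> of the exponent is represented by the homomorphism \<open>(n, a) \<mapsto> ev (n(e), a)\<close>.
  The following formula for \<open>(n, a) \<mapsto> ev (n(t(f)), a)\<close> is forced by evaluating at
  \<open>a = h(\<lambda>i. a)\<close> with \<open>h\<close> the hyperaffine part of \<open>n(t)\<close>.\<close>

definition act :: "'u set \<Rightarrow> 'u \<Rightarrow> ('u \<Rightarrow> 'u \<Rightarrow> 'u \<Rightarrow> 'u) \<Rightarrow> 'u \<Rightarrow> 'u \<Rightarrow> 'u" where
  "act I t f n a = ap B I (hy I (un (free T I) n t)) (\<lambda>i. f i (un (free T one) n (dg I t)) a)"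

text \<open>The operation \<open>s\<close> occurs both in the hyperaffine part and, after the
  \<open>f i\<close> are applied, in their values; \<open>ap_hy_sub\<close> extracts it from both at
  once.\<close>

lemma bihom_act:
  assumes I: "small I" and t: "t \<in> ops T I" and f: "\<And>i. i \<in> I \<Longrightarrow> bihom T (free T one) A B (f i)"
  shows "bihom T (free T one) A B (act I t f)"
  unfolding bihom_def
proof (intro conjI allI impI ballI)
  fix n a assume n: "n \<in> carr (free T one)" and a: "a \<in> carr A"
  then have "f i (un (free T one) n (dg I t)) a \<in> carr B" if "i \<in> I" for i
    using bihom_closed[OF f[OF that]] I t by (simp add: free_ap_closed)
  then show "act I t f n a \<in> carr B"
    unfolding act_def using B I t n by (simp add: ap_closed free_ap_closed)
next
  fix J s n a
  assume J: "small J" and s: "s \<in> ops T J" and n: "\<forall>j\<in>J. n j \<in> carr (free T one)" and a: "\<forall>j\<in>J. a j \<in> carr A"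
  let ?n = "\<lambda>j. un (free T one) (n j) (dg I t)"
  have n': "?n j \<in> ops T one" "un (free T I) (n j) t \<in> ops T I" if "j \<in> J" for j
    using that n I t by (simp_all add: free_ap_closed)
  have "act I t f (ap (free T one) J s n) (ap A J s a) =
     ap B I (hy I (ap (free T I) J s (\<lambda>j. un (free T I) (n j) t)))
       (\<lambda>i. f i (ap (free T one) J s ?n) (ap A J s a))"
    unfolding act_def using I J s n t by (simp add: ap_ap)
  also have "\<dots> = ap B I (hy I (ap (free T I) J s (\<lambda>j. un (free T I) (n j) t)))
       (\<lambda>i. ap B J s (\<lambda>j. f i (?n j) (a j)))"
    using J s n' a by (intro ap_eqI) (simp add: bihom_ap[OF f])
  also have "\<dots> = ap B J s (\<lambda>j. act I t f (n j) (a j))"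
    unfolding act_def using I J s n' a B by (intro ap_hy_sub) (simp_all add: bihom_closed[OF f])
  finally show "act I t f (ap (free T one) J s n) (ap A J s a) = ap B J s (\<lambda>j. act I t f (n j) (a j))" .
qed

text \<open>The operation \<open>n(\<pi>\<^sub>i)\<close> decomposes into the affine
  \<open>\<pi>\<^sub>i\<close> and the unary \<open>n\<close>.\<close>

lemma act_proj:
  assumes I: "small I" and i: "i \<in> I" and f: "\<And>i. i \<in> I \<Longrightarrow> bihom T (free T one) A B (f i)"
    and n: "n \<in> ops T one" and a: "a \<in> carr A"
  shows "act I (proj T I i) f n a = f i n a"
proof -
  have p: "affine T I (proj T I i)"
    unfolding affine_iff using I i by (simp add: ap_proj)
  have "un (free T I) n (proj T I i) = ap (free T I) I (proj T I i) (\<lambda>k. un (free T I) n (proj T I k))"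
    using I i n by (simp add: ap_proj free_ap_closed)
  then have "hy I (un (free T I) n (proj T I i)) = proj T I i"
    using I i p n by (intro hy_unique) simp_all
  moreover have "dg I (proj T I i) = gen T"
    unfolding dg_def using I i by (simp add: ap_proj)
  ultimately show ?thesis
    unfolding act_def using B I i n a by (simp add: ap_proj un_free_gen bihom_closed[OF f])
qed

lemma act_sub:
  assumes I: "small I" and J: "small J" and t: "t \<in> ops T I" and u: "\<And>i. i \<in> I \<Longrightarrow> u i \<in> ops T J"
    and f: "\<And>j. j \<in> J \<Longrightarrow> bihom T (free T one) A B (f j)"
    and n: "n \<in> ops T one" and a: "a \<in> carr A"
  shows "act J (ap (free T J) I t u) f n a = act I t (\<lambda>i. act J (u i) f) n a"
proof -
  let ?h = "hy I (un (free T I) n t)" and ?n = "un (free T one) n (dg I t)"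
  have nt: "un (free T I) n t \<in> ops T I" and n': "?n \<in> ops T one"
    using I n t by (simp_all add: free_ap_closed)
  have h: "?h \<in> ops T I" "affine T I ?h" using I nt by (simp_all add: affine_hy)
  have dg_nt: "dg I (un (free T I) n t) = ?n"
    unfolding dg_def using I n t by (simp add: ap_ap)
  have ntu: "un X n (ap X I t x) = ap X I ?h (\<lambda>i. un X ?n (x i))"
    if "is_model T X" "\<And>i. i \<in> I \<Longrightarrow> x i \<in> carr X" for X x
    using ap_hy[of X I "un (free T I) n t" x] that I n t nt unfolding dg_nt by (simp add: ap_ap)
  have 1: "un (free T J) n (ap (free T J) I t u) = ap (free T J) I ?h (\<lambda>i. un (free T J) ?n (u i))"
    using J u by (intro ntu) simp_all
  have 2: "un (free T one) n (dg J (ap (free T J) I t u)) =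
      ap (free T one) I ?h (\<lambda>i. un (free T one) ?n (dg J (u i)))" (is "_ = ap _ _ _ ?m")
  proof -
    have "dg J (ap (free T J) I t u) = ap (free T one) I t (\<lambda>i. dg J (u i))"
      unfolding dg_def using I J t u by (simp add: ap_ap)
    then show ?thesis using J u by (simp add: ntu)
  qed
  have m: "?m i \<in> ops T one" if "i \<in> I" for i
    using that n' J u by (simp add: free_ap_closed)
  \<comment> \<open>By \<open>ntu\<close>, both \<open>n(t(u))\<close> and its unary part are
    \<open>h\<close> applied to families. Writing \<open>a\<close> as \<open>h\<close> of a constant
    family lets \<open>h\<close> be pulled out of the \<open>f j\<close>, and
    \<open>ap_hy_sub\<close> then moves it to the front.\<close>
  have "act J (ap (free T J) I t u) f n a =
     ap B J (hy J (ap (free T J) I ?h (\<lambda>i. un (free T J) ?n (u i))))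
       (\<lambda>j. f j (ap (free T one) I ?h ?m) (ap A I ?h (\<lambda>_. a)))"
    unfolding act_def 1 2 using affine_ap[OF h(2) A I h(1) a] by simp
  also have "\<dots> = ap B J (hy J (ap (free T J) I ?h (\<lambda>i. un (free T J) ?n (u i))))
       (\<lambda>j. ap B I ?h (\<lambda>i. f j (?m i) a))"
    using I h m a by (intro ap_eqI bihom_ap[OF f]) simp_all
  also have "\<dots> = ap B I ?h (\<lambda>i. ap B J (hy J (un (free T J) ?n (u i))) (\<lambda>j. f j (?m i) a))"
    using I J h m a B n' u by (intro ap_hy_sub) (simp_all add: bihom_closed[OF f] free_ap_closed)
  finally show ?thesis unfolding act_def .
qed

text \<open>This makes evaluation a homomorphism. Decomposing \<open>t\<close> in the action and in
  the argument gives a double application of \<open>h\<close>, which hyperaffineness reduces to its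
  diagonal.\<close>

lemma act_gen:
  assumes I: "small I" and t: "t \<in> ops T I"
    and f: "\<And>i. i \<in> I \<Longrightarrow> bihom T (free T one) A B (f i)" and a: "\<And>i. i \<in> I \<Longrightarrow> a i \<in> carr A"
  shows "act I t f (gen T) (ap A I t a) = ap B I t (\<lambda>i. f i (gen T) (a i))"
proof -
  let ?h = "hy I t" and ?d = "dg I t"
  have h: "?h \<in> ops T I" "affine T I ?h" using I t by (simp_all add: affine_hy)
  have d: "?d \<in> ops T one" using I t by simp
  have da: "un A ?d (a i) \<in> carr A" if "i \<in> I" for i
    using that a d A by (simp add: ap_closed)
  have "act I t f (gen T) (ap A I t a) =
      ap B I ?h (\<lambda>i. f i (ap (free T one) I ?h (\<lambda>_. ?d)) (ap A I ?h (\<lambda>k. un A ?d (a k))))"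
    unfolding act_def using ap_hy[of A I t a] A a I t d
      affine_ap[OF h(2) _ I h(1), of "free T one" ?d] by (simp add: un_gen)
  also have "\<dots> = ap B I ?h (\<lambda>i. ap B I ?h (\<lambda>k. f i ?d (un A ?d (a k))))"
    using I h d da by (intro ap_eqI bihom_ap[OF f]) simp_all
  also have "\<dots> = ap B I ?h (\<lambda>i. f i ?d (un A ?d (a i)))"
    using I h d da B by (intro hyperaffine_ap) (simp_all add: bihom_closed[OF f] hyperaffine_hy t)
  also have "\<dots> = ap B I ?h (\<lambda>i. un B ?d (f i (gen T) (a i)))"
  proof (rule ap_eqI)
    fix i assume i: "i \<in> I"
    \<comment> \<open>The unary operation leaves \<open>f i\<close> because
      \<open>d = d(gen T)\<close>.\<close>
    show "f i ?d (un A ?d (a i)) = un B ?d (f i (gen T) (a i))"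
      using bihom_ap[OF f[OF i] small_one d, of "\<lambda>_. gen T" "\<lambda>_. a i"] a[OF i] d
      by (simp add: un_free_gen)
  qed
  also have "\<dots> = ap B I t (\<lambda>i. f i (gen T) (a i))"
    using B I t a by (subst (2) ap_hy) (simp_all add: bihom_closed[OF f])
  finally show ?thesis .
qed

section \<open>Construction of the exponent\<close>

lemma exponents_if_hyperaffine_unary: "\<exists>E ev. exponent A B E ev"
proof -
  let ?G = "free T one"
  have G: "is_model T ?G" by simp
  obtain S cur where S: "small (S :: 'u set)"
    and cur': "\<forall>e\<in>S. bihom T ?G A B (cur e)"
    and inj': "\<forall>e\<in>S. \<forall>e'\<in>S. (\<forall>n\<in>carr ?G. \<forall>a\<in>carr A. cur e n a = cur e' n a) \<longrightarrow> e = e'"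
    and ex: "\<forall>\<phi>. bihom T ?G A B \<phi> \<longrightarrow> (\<exists>e\<in>S. \<forall>n\<in>carr ?G. \<forall>a\<in>carr A. cur e n a = \<phi> n a)"
    using ex_hom_object[OF G A B] by (elim exE conjE) (rule that)
  have cur: "bihom T ?G A B (cur e)" if "e \<in> S" for e
    using cur' that by blast
  have inj: "e = e'" if "e \<in> S" "e' \<in> S"
    "\<And>n a. n \<in> carr ?G \<Longrightarrow> a \<in> carr A \<Longrightarrow> cur e n a = cur e' n a" for e e'
    using inj' that by blast
  define code where "code \<phi> = (SOME e. e \<in> S \<and> (\<forall>n\<in>carr ?G. \<forall>a\<in>carr A. cur e n a = \<phi> n a))" for \<phi>
  have *: "code \<phi> \<in> S \<and> (\<forall>n\<in>carr ?G. \<forall>a\<in>carr A. cur (code \<phi>) n a = \<phi> n a)"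
    if "bihom T ?G A B \<phi>" for \<phi>
  proof -
    have "\<exists>e. e \<in> S \<and> (\<forall>n\<in>carr ?G. \<forall>a\<in>carr A. cur e n a = \<phi> n a)"
      using spec[OF ex, of \<phi>] that unfolding Bex_def by (rule mp)
    then show ?thesis unfolding code_def by (rule someI_ex)
  qed
  have code: "code \<phi> \<in> S" if "bihom T ?G A B \<phi>" for \<phi>
    using *[OF that] by (rule conjunct1)
  have cur_code: "cur (code \<phi>) n a = \<phi> n a"
    if "bihom T ?G A B \<phi>" "n \<in> ops T one" "a \<in> carr A" for \<phi> n a
    using conjunct2[OF *[OF that(1)]] that(2,3) by simp
  define E where "E = \<lparr>carr = S, interp = (\<lambda>I t e. code (act I t (\<lambda>i. cur (e i))))\<rparr>"
  have carr_E [simp]: "carr E = S" by (simp add: E_def)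
  have ap_E: "ap E I t e = code (act I t (\<lambda>i. cur (e i)))" for I t e
  proof -
    have "act I t (\<lambda>i. cur (restrict e I i)) = act I t (\<lambda>i. cur (e i))"
      unfolding act_def by (intro ext ap_eqI) simp
    then show ?thesis by (simp add: E_def ap_def)
  qed
  have bact: "bihom T ?G A B (act I t (\<lambda>i. cur (e i)))"
    if "small I" "t \<in> ops T I" "\<forall>i\<in>I. e i \<in> S" for I t e
    using that cur by (intro bihom_act) auto
  have E_closed: "ap E I t e \<in> S" and cur_ap: "\<And>n a. n \<in> ops T one \<Longrightarrow> a \<in> carr A \<Longrightarrow>
      cur (ap E I t e) n a = act I t (\<lambda>i. cur (e i)) n a"
    if "small I" "t \<in> ops T I" "\<forall>i\<in>I. e i \<in> S" for I t e
    unfolding ap_E using code[OF bact[OF that]] cur_code[OF bact[OF that]] by simp_all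
  have E: "is_model T E"
    unfolding is_model_iff carr_E
  proof (intro conjI allI impI)
    show "small S" by (rule S)
    show "ap E I t e \<in> S" if "small I" "t \<in> ops T I" "\<forall>i\<in>I. e i \<in> S" for I t e
      using that by (rule E_closed)
    show "ap E I (proj T I i) e = e i" if "small I" "i \<in> I" "\<forall>i\<in>I. e i \<in> S" for I i e
    proof (rule inj)
      show "cur (ap E I (proj T I i) e) n a = cur (e i) n a" if "n \<in> carr ?G" "a \<in> carr A" for n a
        using that \<open>small I\<close> \<open>i \<in> I\<close> \<open>\<forall>i\<in>I. e i \<in> S\<close> cur by (simp add: cur_ap act_proj)
    qed (use that E_closed in simp_all)
    show "ap E J (ap (free T J) I t u) e = ap E I t (\<lambda>i. ap E J (u i) e)"
      if I: "small I" and J: "small J" and t: "t \<in> ops T I" and u: "\<forall>i\<in>I. u i \<in> ops T J"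
        and e: "\<forall>j\<in>J. e j \<in> S" for I J t u e
    proof (rule inj)
      have u': "ap E J (u i) e \<in> S" if "i \<in> I" for i
        using E_closed[OF J _ e] u that by blast
      show "ap E J (ap (free T J) I t u) e \<in> S" "ap E I t (\<lambda>i. ap E J (u i) e) \<in> S"
        using I J t u e u' by (simp_all add: E_closed free_ap_closed)
      fix n a assume n: "n \<in> carr ?G" and a: "a \<in> carr A"
      have "cur (ap E J (ap (free T J) I t u) e) n a = act I t (\<lambda>i. act J (u i) (\<lambda>j. cur (e j))) n a"
        using I J t u e n a cur by (simp add: cur_ap free_ap_closed act_sub)
      also have "\<dots> = act I t (\<lambda>i. cur (ap E J (u i) e)) n a"
        unfolding act_def[of I] using I J t u e n a
        by (intro ap_eqI) (simp add: cur_ap free_ap_closed)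
      also have "\<dots> = cur (ap E I t (\<lambda>i. ap E J (u i) e)) n a"
        using I J t u' n a by (simp add: cur_ap)
      finally show "cur (ap E J (ap (free T J) I t u) e) n a = cur (ap E I t (\<lambda>i. ap E J (u i) e)) n a" .
    qed
  qed
  let ?ev = "\<lambda>e a. cur e (gen T) a"
  have ev: "bihom T E A B ?ev"
    unfolding bihom_def
  proof (intro conjI allI impI ballI)
    show "?ev e a \<in> carr B" if "e \<in> carr E" "a \<in> carr A" for e a
      using that bihom_closed[OF cur] by simp
    show "?ev (ap E I t e) (ap A I t a) = ap B I t (\<lambda>i. ?ev (e i) (a i))"
      if "small I" "t \<in> ops T I" "\<forall>i\<in>I. e i \<in> carr E" "\<forall>i\<in>I. a i \<in> carr A" for I t e a
      using that A cur by (simp add: cur_ap ap_closed act_gen)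
  qed
  \<comment> \<open>Evaluation after all unary operations recovers the homomorphism coded by
    \<open>e\<close>; the uniqueness of transposes rests on this.\<close>
  have ev_un: "?ev (un E n e) a = cur e n a" if n: "n \<in> ops T one" and e: "e \<in> S" and a: "a \<in> carr A" for n e a
  proof -
    have "?ev (un E n e) a = act one n (\<lambda>_. cur e) (gen T) a"
      using n e a by (simp add: cur_ap)
    also have "\<dots> = ap B one (hy one n) (\<lambda>_. cur e n a)"
      unfolding act_def dg_def using n by (simp add: un_gen un_free_gen)
    also have "\<dots> = cur e n a"
      using n e a B by (intro affine_ap affine_hy) (simp_all add: bihom_closed[OF cur])
    finally show ?thesis .
  qed
  have "exponent A B E ?ev"
    unfolding exponent_def
  proof (intro conjI allI impI)
    show "is_model T E" "bihom T E A B ?ev" by fact+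
  next
    fix W g assume W: "is_model T W" and g: "bihom T W A B g"
    \<comment> \<open>The form of the transpose is forced by \<open>ev_un\<close>: its value at
      \<open>w\<close> must send \<open>(n, a)\<close> to the evaluation of the transpose of
      \<open>n(w)\<close> at \<open>a\<close>.\<close>
    let ?\<phi> = "\<lambda>w n a. g (un W n w) a"
    have \<phi>: "bihom T ?G A B (?\<phi> w)" if "w \<in> carr W" for w
      using that by (intro bihom_precomp[OF g hom_eval[OF small_one W] hom_id])
    let ?f = "\<lambda>w. code (?\<phi> w)"
    have "hom T W E ?f"
      unfolding hom_def
    proof (intro conjI allI impI ballI)
      show "?f w \<in> carr E" if "w \<in> carr W" for w using code[OF \<phi>[OF that]] by simp
      fix I t w assume I: "small I" and t: "t \<in> ops T I" and w: "\<forall>i\<in>I. w i \<in> carr W"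
      have fw: "\<forall>i\<in>I. ?f (w i) \<in> S" using w code[OF \<phi>] by simp
      have tw: "ap W I t w \<in> carr W" using I t w W by (simp add: ap_closed)
      show "?f (ap W I t w) = ap E I t (\<lambda>i. ?f (w i))"
      proof (rule inj)
        show "?f (ap W I t w) \<in> S" using code[OF \<phi>[OF tw]] .
        show "ap E I t (\<lambda>i. ?f (w i)) \<in> S" using I t fw by (rule E_closed)
        fix n a assume n: "n \<in> carr ?G" and a: "a \<in> carr A"
        let ?nt = "un (free T I) n t"
        have nt: "?nt \<in> ops T I" using I n t by (simp add: free_ap_closed)
        have dg_nt: "dg I ?nt = un ?G n (dg I t)"
          unfolding dg_def using I n t by (simp add: ap_ap)
        let ?h = "hy I ?nt" and ?m = "un ?G n (dg I t)"
        have m: "?m \<in> ops T one" using I n t by (simp add: free_ap_closed)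
        have h: "?h \<in> ops T I" "affine T I ?h" using I nt by (simp_all add: affine_hy)
        have "cur (?f (ap W I t w)) n a = g (un W n (ap W I t w)) a"
          using cur_code[OF \<phi>[OF tw]] n a by simp
        also have "un W n (ap W I t w) = ap W I ?nt w"
          using W I n t w by (simp add: ap_ap)
        also have "\<dots> = ap W I ?h (\<lambda>i. un W ?m (w i))"
          using ap_hy[OF W I nt, of w] w by (simp add: dg_nt)
        \<comment> \<open>The second argument becomes \<open>h\<close> of a constant family, so that
          \<open>g\<close> can be applied as a homomorphism on the product.\<close>
        also have "g (ap W I ?h (\<lambda>i. un W ?m (w i))) a = g (ap W I ?h (\<lambda>i. un W ?m (w i))) (ap A I ?h (\<lambda>_. a))"
          using affine_ap[OF h(2) A I h(1) a] by simp
        also have "\<dots> = ap B I ?h (\<lambda>i. g (un W ?m (w i)) a)"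
          using I h W w m a by (intro bihom_ap[OF g]) (simp_all add: ap_closed)
        also have "\<dots> = act I t (\<lambda>i. cur (?f (w i))) n a"
          unfolding act_def using w m a cur_code[OF \<phi>] by (intro ap_eqI) simp
        also have "\<dots> = cur (ap E I t (\<lambda>i. ?f (w i))) n a"
          using cur_ap[OF I t fw] n a by simp
        finally show "cur (?f (ap W I t w)) n a = cur (ap E I t (\<lambda>i. ?f (w i))) n a" .
      qed
    qed
    moreover have "?ev (?f w) a = g w a" if "w \<in> carr W" "a \<in> carr A" for w a
      using cur_code[OF \<phi>[OF that(1)] gen_closed that(2)] un_gen[OF W that(1)] by simp
    ultimately show "\<exists>f. hom T W E f \<and> (\<forall>w\<in>carr W. \<forall>a\<in>carr A. ?ev (f w) a = g w a)"
      by blast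
  next
    fix W f f' assume W: "is_model T W" and f: "hom T W E f" "hom T W E f'"
      and eq: "\<forall>w\<in>carr W. \<forall>a\<in>carr A. ?ev (f w) a = ?ev (f' w) a"
    show "\<forall>w\<in>carr W. f w = f' w"
    proof (rule ballI, rule inj)
      fix w assume w: "w \<in> carr W"
      show "f w \<in> S" "f' w \<in> S" using hom_closed[OF f(1) w] hom_closed[OF f(2) w] by simp_all
      fix n a assume n: "n \<in> carr ?G" and a: "a \<in> carr A"
      \<comment> \<open>Since \<open>k\<close> commutes with \<open>n\<close>, the coded
        homomorphism of \<open>k w\<close> is determined by evaluations of \<open>k\<close> on all
        \<open>n(w)\<close>.\<close>
      have cf: "cur (k w) n a = ?ev (k (un W n w)) a" if k: "hom T W E k" for k
        using hom_ap[OF k small_one, of n "\<lambda>_. w"] n w a hom_closed[OF k w] by (simp add: ev_un)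
      have "un W n w \<in> carr W" using W n w by (simp add: ap_closed)
      then show "cur (f w) n a = cur (f' w) n a"
        using eq a by (simp add: cf[OF f(1)] cf[OF f(2)])
    qed
  qed
  then show ?thesis by blast
qed

end

end

end

theorem theorem5p5:
  fixes T :: "'u::set_universe alg_theory"
  assumes "algebraic_theory T"
  shows "cartesian_closed (Mod T) \<longleftrightarrow> hyperaffine_unary T"
proof -
  interpret algebraic_theory T by fact
  show ?thesis
    unfolding cartesian_closed_Mod_iff
    using hyperaffine_unary_if_exponents exponents_if_hyperaffine_unary by blast
qed

end
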